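(* Let $s\in\mathbb{C}$ with $\operatorname{Re}s>\log_bN$ and let $\kappa=\frac{b-1}{f}$. Then, as the real variable $m\to+\infty$, $\kappa^m m^s u_m(s)$ differs by $O(1/m)$ from the function $$G_s(m)=\frac{1}{\log b}\sum_{k=-\infty}^{\infty}e^{2\pi i k\log_b(m)}\,\Gamma\!\Bigl(s-\frac{2\pi i k}{\log b}\Bigr)\sum_{n\in\mathcal{B}}\frac{1}{(\kappa n+1)^{\,s-\frac{2\pi i k}{\log b}}},$$ which is a smooth $1$-periodic function of $\log_b(m)$ and equals $$G_s(m)=m^s\sum_{j=-\infty}^{\infty}b^{js}\sum_{n\in\mathcal{B}}e^{-(\kappa n+1)b^jm}.$$ Moreover the asymptotic average of the scaled integer moments is $$\lim_{p\to\infty}\ \sum_{\substack{m\in\mathbb{Z}\\ b^p<m\le b^{p+1}}} \kappa^m m^s u_m(s)\,\log_b\!\frac{m}{m-1}=\frac{\Gamma(s)}{\log b}\sum_{n\in\mathcal{B}}\frac{1}{(\kappa n+1)^s}.$$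
   Context: Let $b\ge 2$ be an integer and $A\subset\{0,1,\dots,b-1\}$ a nonempty set of digits with $N=\#A$ and $f=\max A>0$ (no assumption that $f=b-1$). For $s\in\mathbb{C}$ with $\operatorname{Re}s>\log_b N$, $\mu_s$ is the discrete complex Borel measure on $[0,1)$ $$\mu_s=\delta_0+\sum_{l=1}^{\infty}\ \sum_{(a_1,\dots,a_l)\in A^l} b^{-ls}\,\delta_{a_1b^{-1}+\cdots+a_lb^{-l}},$$ where $\delta_y$ denotes the unit Dirac mass at $y$, and for real $m\ge0$ its moments are $$u_m(s)=\int_{[0,1)}x^m\,\mu_s(dx)=0^m+\sum_{l=1}^\infty\sum_{(a_1,\dots,a_l)\in A^l}\bigl(a_1b^{-1}+\cdots+a_lb^{-l}\bigr)^m b^{-ls}\quad(0^0=1).$$ Let $B=\{f-a: a\in A\}$ and let $\mathcal{B}$ be the set of non-negative integers whose radix-$b$ representation uses only digits from $B$ (the integer $0$, represented by the empty word, always belongs to $\mathcal{B}$). Powers use the principal branch, and $\Gamma$ is Euler's Gamma function. *)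

theory Defs
  imports "HOL-Analysis.Analysis"
begin

definition wval :: "nat \<Rightarrow> nat list \<Rightarrow> real" where
  "wval b w = (\<Sum>i<length w. real (w ! i) / real b ^ Suc i)"

definition rpow0 :: "real \<Rightarrow> real \<Rightarrow> real" where
  "rpow0 x m = (if x = 0 then (if m = 0 then 1 else 0) else x powr m)"

definition moment :: "nat \<Rightarrow> nat set \<Rightarrow> complex \<Rightarrow> real \<Rightarrow> complex" where
  "moment b A s m =
     complex_of_real (rpow0 0 m) +
     (\<Sum>l. \<Sum>w\<in>{w. length w = Suc l \<and> set w \<subseteq> A}.
        complex_of_real (rpow0 (wval b w) m) * (of_nat b) powr (- (of_nat (Suc l) * s)))"

text \<open>Non-negative integers whose radix-b representation uses only digits from D
  (0, the empty word, always belongs).\<close>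
definition digits_in :: "nat \<Rightarrow> nat set \<Rightarrow> nat set" where
  "digits_in b D = {n. \<forall>i. b ^ i \<le> n \<longrightarrow> (n div b ^ i) mod b \<in> D}"

definition dirichlet :: "real \<Rightarrow> nat set \<Rightarrow> complex \<Rightarrow> complex" where
  "dirichlet \<kappa> Bs z = infsum (\<lambda>n. inverse ((complex_of_real (\<kappa> * real n + 1)) powr z)) Bs"

text \<open>The Fourier-series form of G_s, as a function of t = log_b m.\<close>
definition Gfourier :: "nat \<Rightarrow> real \<Rightarrow> nat set \<Rightarrow> complex \<Rightarrow> real \<Rightarrow> complex" where
  "Gfourier b \<kappa> Bs s t =
     inverse (complex_of_real (ln (real b))) *
     infsum (\<lambda>k::int. exp (2 * of_real pi * \<i> * of_int k * of_real t) *
        Gamma (s - 2 * of_real pi * \<i> * of_int k / of_real (ln (real b))) *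
        dirichlet \<kappa> Bs (s - 2 * of_real pi * \<i> * of_int k / of_real (ln (real b)))) UNIV"

definition Gtheta :: "nat \<Rightarrow> real \<Rightarrow> nat set \<Rightarrow> complex \<Rightarrow> real \<Rightarrow> complex" where
  "Gtheta b \<kappa> Bs s m =
     (complex_of_real m) powr s *
     infsum (\<lambda>j::int. (of_nat b) powr (of_int j * s) *
        infsum (\<lambda>n. exp (- complex_of_real ((\<kappa> * real n + 1) * real b powr (real_of_int j) * m))) Bs) UNIV"

end

theory Submission
  imports Defs
begin

text \<open>A word of length l with digit complements forming the integer n has value w with
  \<open>\<kappa> w = 1 - (\<kappa> n + 1) / b^l\<close>, so the scaled moment is a double sum over n and l of
  \<open>m^s b^{-ls} (1 - y)^m\<close> with \<open>y = (\<kappa> n + 1) / b^l\<close>. Since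
  \<open>0 \<le> e^{-my} - (1 - y)^m \<le> m y^2 e^{-my}\<close>, replacing \<open>(1 - y)^m\<close> by \<open>e^{-my}\<close>, and summing over all
  integers l, costs O(1/m) and gives the theta-like form of G. After rescaling by \<open>\<kappa> n + 1\<close> this form reduces to
  a single 1-periodic function, whose Fourier coefficients are Mellin integrals of \<open>e^{-x}\<close>, that is, values of
  Gamma on a vertical line; they decay rapidly because \<open>|z|^n |Gamma(z)| \<le> Gamma(Re z + n)\<close>. The average is a Riemann
  sum of G over one period, compared with the constant coefficient by means of a periodic primitive of
  \<open>G\<close> minus that coefficient.\<close>

section \<open>Fourier inversion for Lipschitz periodic functions\<close>

text \<open>The assumption on \<open>Re s\<close> enters through absolute convergence of the sum of
  \<open>(\<kappa> n + 1) powr - Re s\<close> over the restricted integers, and through its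
  consequence \<open>Re s > 0\<close> in the estimates of kernels and of Gamma. Rescaling by
  \<open>\<kappa> n + 1\<close> becomes a translation once everything is written in the variable
  log_b m: the theta sum of a single kernel is evaluated at t +
  log_b(\<open>\<kappa> n + 1\<close>). On the Fourier side the translation multiplies the k-th
  coefficient by a phase, and the weighted sum of these phases over n is the Dirichlet series at s -
  2 pi i k / ln b. The theta form and the Fourier form of G thus meet in one double sum over n and
  the translates j. The delicate point is pointwise Fourier inversion for the single kernel:
  Lipschitz continuity of its periodization together with absolutely summable coefficients is
  enough, and both follow from exponential decay of the kernel and the decay of Gamma. All
  interchanges of sums rest on bounds uniform in the translation.\<close>

definition fmode :: "int \<Rightarrow> real \<Rightarrow> complex" where
  "fmode k t = cis (2 * pi * of_int k * t)"

lemma fmode_0 [simp]: "fmode 0 t = 1"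
  by (simp add: fmode_def)

lemma norm_fmode [simp]: "norm (fmode k t) = 1"
  by (simp add: fmode_def)

lemma fmode_add: "fmode (k + l) t = fmode k t * fmode l t"
  by (simp add: fmode_def cis_mult algebra_simps)

lemma fmode_add_right: "fmode k (x + y) = fmode k x * fmode k y"
  by (simp add: fmode_def cis_mult algebra_simps)

lemma cnj_fmode [simp]: "cnj (fmode k t) = fmode (- k) t"
  by (simp add: fmode_def cis_cnj)

lemma fmode_minus_right: "fmode k (- t) = fmode (- k) t"
  by (simp add: fmode_def)

lemma fmode_of_int [simp]: "fmode k (of_int n) = 1"
proof -
  have "fmode k (of_int n) = cis (2 * pi * of_int (k * n))"
    by (simp add: fmode_def algebra_simps)
  also have "\<dots> = 1"
    by (intro cis_multiple_2pi) auto
  finally show ?thesis .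
qed

lemma fmode_1 [simp]: "fmode k 1 = 1"
  using fmode_of_int[of k 1] by simp

lemma has_vector_derivative_fmode:
  "(fmode k has_vector_derivative (2 * pi * \<i> * of_int k * fmode k t)) (at t within S)"
proof -
  have eq: "fmode k = (\<lambda>t. exp (t *\<^sub>R (2 * pi * \<i> * of_int k)))"
    by (simp add: fun_eq_iff fmode_def cis_conv_exp scaleR_conv_of_real mult_ac)
  show ?thesis
    using exp_scaleR_has_vector_derivative_right[of "2 * pi * \<i> * of_int k" t S]
    unfolding eq by (simp add: mult_ac)
qed

lemma continuous_on_fmode [continuous_intros]: "continuous_on S (fmode k)"
  using has_vector_derivative_fmode has_vector_derivative_continuous
  by (blast intro: continuous_at_imp_continuous_on)

section \<open>Square-summability of Fourier coefficients over one period\<close>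

abbreviation unit_interval :: "real measure" where
  "unit_interval \<equiv> lebesgue_on {0..1}"

lemma measurable_unit_intervalI:
  fixes f :: "real \<Rightarrow> complex"
  shows "continuous_on UNIV f \<Longrightarrow> f \<in> borel_measurable unit_interval"
  by (rule continuous_imp_measurable_on_sets_lebesgue) (auto intro: continuous_on_subset)

lemma measurable_fmode [measurable]: "fmode k \<in> borel_measurable unit_interval"
  by (intro measurable_unit_intervalI continuous_intros)

lemma integrable_unit_interval:
  fixes f :: "real \<Rightarrow> complex"
  assumes "f \<in> borel_measurable unit_interval" "\<And>t. norm (f t) \<le> B"
  shows "integrable unit_interval f"
proof (rule finite_measure.integrable_const_bound)
  show "finite_measure unit_interval"
    by (rule finite_measure_lebesgue_on) auto
qed (use assms in auto)

lemma has_integral_fmode: "(fmode k has_integral (if k = 0 then 1 else 0)) {0..1}"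
proof (cases "k = 0")
  case True
  then show ?thesis
    using has_integral_const_real[of "1::complex" 0 1] by (simp add: fmode_def[abs_def])
next
  case False
  have "(fmode k has_integral (fmode k 1 / (2 * pi * \<i> * of_int k) - fmode k 0 / (2 * pi * \<i> * of_int k))) {0..1}"
  proof (rule fundamental_theorem_of_calculus)
    fix x :: real
    have "((\<lambda>t. fmode k t / (2 * pi * \<i> * of_int k)) has_vector_derivative
        (2 * pi * \<i> * of_int k * fmode k x) / (2 * pi * \<i> * of_int k)) (at x within {0..1})"
      by (intro has_vector_derivative_divide has_vector_derivative_fmode)
    then show "((\<lambda>t. fmode k t / (2 * pi * \<i> * of_int k)) has_vector_derivative fmode k x) (at x within {0..1})"
      using False by simp
  qed simp
  then show ?thesis
    using False by (simp add: fmode_def)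
qed

lemma integral_fmode: "integral\<^sup>L unit_interval (fmode k) = (if k = 0 then 1 else 0)"
  using has_integral_fmode[of k]
  by (subst lebesgue_integral_eq_integral)
     (auto intro!: integrable_unit_interval[of _ 1] simp: integral_unique)

lemma borel_measurable_cnj [measurable]: "cnj \<in> borel_measurable borel"
  by (intro borel_measurable_continuous_onI continuous_intros)

text \<open>The integral of |g - P|^2 is nonnegative, where P is the part of the Fourier series of g
  with frequencies in K. A sup bound B replaces the L^2 norm because the quotient to which this is
  applied is known only through a uniform bound.\<close>

lemma bessel_inequality:
  fixes g :: "real \<Rightarrow> complex"
  assumes [measurable]: "g \<in> borel_measurable unit_interval" and B: "\<And>t. norm (g t) \<le> B"
    and K: "finite K"
  defines "c \<equiv> \<lambda>k. integral\<^sup>L unit_interval (\<lambda>t. g t * fmode (- k) t)"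
  shows "(\<Sum>k\<in>K. (norm (c k))\<^sup>2) \<le> B\<^sup>2"
proof -
  let ?I = "integral\<^sup>L unit_interval"
  have B0: "B \<ge> 0"
    using B[of 0] norm_ge_zero order_trans by blast
  define P where "P = (\<lambda>t. \<Sum>k\<in>K. c k * fmode k t)"
  have [measurable]: "P \<in> borel_measurable unit_interval"
    unfolding P_def by measurable
  have normP: "norm (P t) \<le> (\<Sum>k\<in>K. norm (c k))" for t
    unfolding P_def by (rule order_trans[OF norm_sum]) (simp add: norm_mult)
  have i1: "integrable unit_interval (\<lambda>t. g t * cnj (g t))"
    using B B0 by (intro integrable_unit_interval[of _ "B * B"]) (auto simp: norm_mult intro!: mult_mono)
  have i2: "integrable unit_interval (\<lambda>t. cnj (c k) * (g t * fmode (- k) t))" for k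
    using B B0 by (intro integrable_unit_interval[of _ "norm (c k) * B"]) (auto simp: norm_mult intro!: mult_mono)
  have i3: "integrable unit_interval (\<lambda>t. c k * cnj (g t * fmode (- k) t))" for k
    using B B0 by (intro integrable_unit_interval[of _ "norm (c k) * B"]) (auto simp: norm_mult intro!: mult_mono)
  have i4: "integrable unit_interval (\<lambda>t. c k * cnj (c l) * fmode (k - l) t)" for k l
    by (intro integrable_unit_interval[of _ "norm (c k) * norm (c l)"]) (auto simp: norm_mult)
  have e3: "?I (\<lambda>t. c k * cnj (g t * fmode (- k) t)) = c k * cnj (c k)" for k
    by (simp only: integral_mult_right_zero Bochner_Integration.integral_cnj c_def)
  have e2: "?I (\<lambda>t. cnj (c k) * (g t * fmode (- k) t)) = cnj (c k) * c k" for k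
    by (simp only: integral_mult_right_zero c_def)
  have e4: "?I (\<lambda>t. c k * cnj (c l) * fmode (k - l) t) = (if k = l then c k * cnj (c k) else 0)" for k l
    by (subst integral_mult_right_zero, subst integral_fmode) simp
  \<comment> \<open>Squared moduli are written as z times its conjugate, so that the expansion is
    purely algebraic and can be integrated term by term.\<close>
  have expand: "(g t - P t) * cnj (g t - P t) = g t * cnj (g t)
      - (\<Sum>k\<in>K. cnj (c k) * (g t * fmode (- k) t)) - (\<Sum>k\<in>K. c k * cnj (g t * fmode (- k) t))
      + (\<Sum>k\<in>K. \<Sum>l\<in>K. c k * cnj (c l) * fmode (k - l) t)" for t
  proof -
    have cP: "cnj (P t) = (\<Sum>k\<in>K. cnj (c k) * fmode (- k) t)"
      by (simp add: P_def)
    have "P t * cnj (P t) = (\<Sum>k\<in>K. \<Sum>l\<in>K. c k * cnj (c l) * fmode (k - l) t)"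
      unfolding cP unfolding P_def sum_product diff_conv_add_uminus fmode_add
      by (intro sum.cong refl) (simp add: mult_ac)
    moreover have "g t * cnj (P t) = (\<Sum>k\<in>K. cnj (c k) * (g t * fmode (- k) t))"
      unfolding cP by (simp add: sum_distrib_left mult_ac)
    moreover have "P t * cnj (g t) = (\<Sum>k\<in>K. c k * cnj (g t * fmode (- k) t))"
      unfolding P_def by (simp add: sum_distrib_right sum_distrib_left mult_ac)
    ultimately show ?thesis
      by (simp add: algebra_simps)
  qed
  have "?I (\<lambda>t. (g t - P t) * cnj (g t - P t)) = ?I (\<lambda>t. g t * cnj (g t))
      - (\<Sum>k\<in>K. cnj (c k) * c k) - (\<Sum>k\<in>K. c k * cnj (c k))
      + (\<Sum>k\<in>K. \<Sum>l\<in>K. if k = l then c k * cnj (c k) else 0)"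
    unfolding expand
    by (simp only: Bochner_Integration.integral_add Bochner_Integration.integral_diff
        Bochner_Integration.integral_sum i1 i2 i3 i4 e2 e3 e4
        Bochner_Integration.integrable_sum Bochner_Integration.integrable_diff Bochner_Integration.integrable_add)
  \<comment> \<open>Both cross terms and the diagonal of the double sum equal the sum of |c k|^2;
    counted with their signs, one negative copy remains.\<close>
  also have "\<dots> = ?I (\<lambda>t. g t * cnj (g t)) - (\<Sum>k\<in>K. c k * cnj (c k))"
    using K by (simp add: mult.commute)
  finally have eq: "?I (\<lambda>t. complex_of_real ((norm (g t - P t))\<^sup>2)) = ?I (\<lambda>t. complex_of_real ((norm (g t))\<^sup>2)) - complex_of_real (\<Sum>k\<in>K. (norm (c k))\<^sup>2)"
    by (simp only: complex_norm_square of_real_sum)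
  then have "?I (\<lambda>t. (norm (g t - P t))\<^sup>2) = ?I (\<lambda>t. (norm (g t))\<^sup>2) - (\<Sum>k\<in>K. (norm (c k))\<^sup>2)"
    unfolding integral_complex_of_real of_real_diff[symmetric] of_real_eq_iff .
  moreover have "0 \<le> ?I (\<lambda>t. (norm (g t - P t))\<^sup>2)"
    by simp
  moreover have "?I (\<lambda>t. (norm (g t))\<^sup>2) \<le> B\<^sup>2"
  proof -
    interpret finite_measure unit_interval
      by (rule finite_measure_lebesgue_on) auto
    have "?I (\<lambda>t. (norm (g t))\<^sup>2) \<le> ?I (\<lambda>t. B\<^sup>2)"
      using B B0 by (intro integral_mono integrable_const_bound[of _ "B\<^sup>2"]) (auto intro!: power_mono)
    also have "\<dots> = B\<^sup>2"
      by (simp add: measure_restrict_space)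
    finally show ?thesis .
  qed
  ultimately show ?thesis
    by linarith
qed

text \<open>Bessel's inequality makes the squared coefficients summable along any sequence of
  distinct frequencies, hence null. An arbitrary injective \<open>\<sigma>\<close> serves both ends
  of the two-sided series.\<close>

lemma riemann_lebesgue:
  fixes g :: "real \<Rightarrow> complex" and \<sigma> :: "nat \<Rightarrow> int"
  assumes "g \<in> borel_measurable unit_interval" "\<And>t. norm (g t) \<le> B" "inj \<sigma>"
  shows "(\<lambda>n. integral\<^sup>L unit_interval (\<lambda>t. g t * fmode (- \<sigma> n) t)) \<longlonglongrightarrow> 0"
proof -
  define c where "c = (\<lambda>k. integral\<^sup>L unit_interval (\<lambda>t. g t * fmode (- k) t))"
  have "summable (\<lambda>n. (norm (c (\<sigma> n)))\<^sup>2)"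
  proof (rule summableI_nonneg_bounded)
    fix n
    have "(\<Sum>i<n. (norm (c (\<sigma> i)))\<^sup>2) = (\<Sum>k\<in>\<sigma> ` {..<n}. (norm (c k))\<^sup>2)"
      using assms(3) by (subst sum.reindex) (auto intro: inj_on_subset)
    also have "\<dots> \<le> B\<^sup>2"
      unfolding c_def by (rule bessel_inequality) (use assms in auto)
    finally show "(\<Sum>i<n. (norm (c (\<sigma> i)))\<^sup>2) \<le> B\<^sup>2" .
  qed simp
  then have "(\<lambda>n. (norm (c (\<sigma> n)))\<^sup>2) \<longlonglongrightarrow> 0"
    by (rule summable_LIMSEQ_zero)
  then have "(\<lambda>n. norm (c (\<sigma> n))) \<longlonglongrightarrow> 0"
    using tendsto_real_sqrt by fastforce
  then show ?thesis
    unfolding c_def by (rule tendsto_norm_zero_cancel)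
qed

text \<open>The windows eventually contain every finite set of integers. They are half-open so that
  the cells [j, j+1] with j in the window tile [-n, n] exactly.\<close>

lemma has_sum_int_symmetric_partial_sums:
  fixes f :: "int \<Rightarrow> 'a :: {comm_monoid_add, topological_space}"
  assumes "(f has_sum S) UNIV"
  shows "(\<lambda>n. \<Sum>k\<in>{- int n..<int n}. f k) \<longlonglongrightarrow> S"
proof -
  have "filterlim (\<lambda>n. {- int n..<int n}) (finite_subsets_at_top UNIV) sequentially"
    unfolding filterlim_iff eventually_finite_subsets_at_top
  proof (intro allI impI)
    fix P :: "int set \<Rightarrow> bool"
    assume "\<exists>X. finite X \<and> X \<subseteq> UNIV \<and> (\<forall>Y. finite Y \<and> X \<subseteq> Y \<and> Y \<subseteq> UNIV \<longrightarrow> P Y)"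
    then obtain X where X: "finite X" "\<And>Y. finite Y \<Longrightarrow> X \<subseteq> Y \<Longrightarrow> P Y"
      by auto
    define M where "M = Max (insert 0 (abs ` X))"
    have M: "\<bar>x\<bar> \<le> M" if "x \<in> X" for x
      unfolding M_def using X(1) that by (intro Max_ge) auto
    show "\<forall>\<^sub>F n in sequentially. P {- int n..<int n}"
      using eventually_gt_at_top[of "nat M"]
    proof eventually_elim
      case (elim n)
      show ?case
        by (rule X(2)) (use M elim in force)+
    qed
  qed
  then show ?thesis
    using assms unfolding has_sum_def by (rule filterlim_compose[rotated])
qed

text \<open>A crude form of Jordan's inequality: x^3 / 6 is at most x / 2 as soon as x^2 is at most
  3, and (pi / 2)^2 is below 3.\<close>

lemma sin_ge_half:
  fixes x :: real
  assumes "0 \<le> x" "x \<le> pi / 2"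
  shows "sin x \<ge> x / 2"
proof -
  have "x \<le> 1.6"
    using assms pi_less_4 pi_approx by simp
  then have "x ^ 2 \<le> 3"
    using power_mono[of x "1.6" 2] assms by (simp add: power2_eq_square)
  then have "x * x\<^sup>2 \<le> x * 3"
    using assms by (intro mult_left_mono) auto
  moreover have "\<bar>sin x - x\<bar> \<le> x ^ 3 / 6"
    using Maclaurin_sin_bound[of x 3] assms by (simp add: sin_coeff_def eval_nat_numeral)
  moreover have "x ^ 3 = x * x\<^sup>2"
    by (simp add: power3_eq_cube power2_eq_square)
  ultimately show ?thesis
    by linarith
qed

text \<open>The chord from 1 to e^{2 pi i v} has length 2 |sin (pi v)|. The linear lower bound is
  what keeps a Lipschitz numerator divided by this chord bounded.\<close>

lemma norm_fmode_minus_1_ge: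
  assumes "\<bar>v\<bar> \<le> 1 / 2"
  shows "norm (fmode 1 v - 1) \<ge> 2 * \<bar>v\<bar>"
proof -
  have "norm (fmode 1 v - 1) = 2 * \<bar>sin (pi * v)\<bar>"
  proof -
    have "(norm (fmode 1 v - 1))\<^sup>2 = (2 * \<bar>sin (pi * v)\<bar>)\<^sup>2"
    proof -
      have "(norm (fmode 1 v - 1))\<^sup>2 = (cos (2 * (pi * v)) - 1)\<^sup>2 + (sin (2 * (pi * v)))\<^sup>2"
        by (simp add: fmode_def cmod_power2 mult_ac)
      also have "\<dots> = 2 - 2 * cos (2 * (pi * v))"
        using sin_cos_squared_add[of "2 * (pi * v)"] by (simp add: power2_eq_square algebra_simps)
      also have "\<dots> = (2 * \<bar>sin (pi * v)\<bar>)\<^sup>2"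
        unfolding cos_double_sin by (simp add: power2_eq_square)
      finally show ?thesis .
    qed
    then show ?thesis
      by (rule power2_eq_imp_eq) auto
  qed
  moreover have "\<bar>sin (pi * v)\<bar> = sin (pi * \<bar>v\<bar>)"
  proof -
    have "sin (pi * \<bar>v\<bar>) \<ge> 0"
      using assms by (intro sin_ge_zero) auto
    then show ?thesis
      by (cases "v \<ge> 0") auto
  qed
  moreover have "sin (pi * \<bar>v\<bar>) \<ge> pi * \<bar>v\<bar> / 2"
    using assms by (intro sin_ge_half) auto
  moreover have "pi * \<bar>v\<bar> \<ge> 2 * \<bar>v\<bar>"
    using pi_ge_two by (intro mult_right_mono) auto
  ultimately show ?thesis
    by linarith
qed

lemma periodic_of_int:
  fixes f :: "real \<Rightarrow> 'a"
  assumes "\<And>t. f (t + 1) = f t"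
  shows "f (t + of_int n) = f t"
proof (induction n rule: int_induct[where k = 0])
  case (step1 i)
  then show ?case using assms[of "t + of_int i"] by (simp add: algebra_simps)
next
  case (step2 i)
  then show ?case using assms[of "t + of_int (i - 1)"] by (simp add: algebra_simps)
qed simp

text \<open>Chernoff's argument: dividing f - f t0 by fmode 1 (t - t0) - 1 makes the partial
  sums of the Fourier series telescope.\<close>

theorem fourier_inversion:
  fixes f :: "real \<Rightarrow> complex"
  assumes per: "\<And>t. f (t + 1) = f t"
    and lip: "\<And>x y. \<bar>x - y\<bar> \<le> 1 \<Longrightarrow> norm (f x - f y) \<le> M * \<bar>x - y\<bar>"
    and coeff: "\<And>k. ((\<lambda>t. f t * fmode (- k) t) has_integral c k) {0..1}"
    and summ: "(\<lambda>k. norm (c k)) summable_on UNIV"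
  shows "((\<lambda>k. c k * fmode k t0) has_sum f t0) UNIV"
proof -
  let ?I = "integral\<^sup>L unit_interval"
  have cont: "continuous_on UNIV f"
    unfolding continuous_on_iff
  proof (intro ballI allI impI)
    fix x e :: real assume "e > 0"
    have M: "M \<ge> 0"
      using lip[of 1 0] norm_ge_zero[of "f 1 - f 0"] by (simp del: norm_ge_zero)
    show "\<exists>d>0. \<forall>x'\<in>UNIV. dist x' x < d \<longrightarrow> dist (f x') (f x) < e"
    proof (intro exI[of _ "min 1 (e / (M + 1))"] conjI ballI impI)
      fix x' assume "dist x' x < min 1 (e / (M + 1))"
      then have d: "\<bar>x' - x\<bar> \<le> 1" "\<bar>x' - x\<bar> < e / (M + 1)"
        by (auto simp: dist_real_def)
      have "norm (f x' - f x) \<le> (M + 1) * \<bar>x' - x\<bar>"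
        using lip[OF d(1)] by (simp add: algebra_simps)
      also have "\<dots> < e"
        using d(2) M by (simp add: field_simps)
      finally show "dist (f x') (f x) < e" by (simp add: dist_norm)
    qed (use M \<open>e > 0\<close> in auto)
  qed
  have [measurable]: "f \<in> borel_measurable unit_interval"
    using cont by (rule measurable_unit_intervalI)
  define d where "d = (\<lambda>t. fmode 1 (t - t0) - 1)"
  have [measurable]: "d \<in> borel_measurable unit_interval"
    unfolding d_def fmode_def by (intro measurable_unit_intervalI continuous_intros)
  define g where "g = (\<lambda>t. (f t - f t0) / d t)"
  have [measurable]: "g \<in> borel_measurable unit_interval"
    unfolding g_def by measurable
  \<comment> \<open>Let v be the offset of t - t0 from the nearest integer. The numerator is at most
    M |v| and the denominator at least 2 |v|. If \<open>d t = 0\<close>, then v = 0, so the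
    numerator vanishes too and the default value 0 of the division is consistent.\<close>
  have gd: "f t - f t0 = g t * d t" and gB: "norm (g t) \<le> M" for t
  proof -
    define n where "n = round (t - t0)"
    define v where "v = t - t0 - of_int n"
    have v: "\<bar>v\<bar> \<le> 1 / 2"
      using of_int_round_abs_le[of "t - t0"] by (simp add: v_def n_def abs_minus_commute)
    have t: "t = t0 + v + of_int n"
      by (simp add: v_def)
    have "f t = f (t0 + v)"
      unfolding t by (rule periodic_of_int) (rule per)
    then have 1: "norm (f t - f t0) \<le> M * \<bar>v\<bar>"
      using lip[of "t0 + v" t0] v by simp
    have "d t = fmode 1 (v + of_int n) - 1"
      by (simp add: d_def t)
    then have "d t = fmode 1 v - 1"
      by (simp add: fmode_add_right)
    then have 2: "norm (d t) \<ge> 2 * \<bar>v\<bar>"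
      using norm_fmode_minus_1_ge[OF v] by simp
    have M: "M \<ge> 0"
      using lip[of 1 0] norm_ge_zero[of "f 1 - f 0"] by (simp del: norm_ge_zero)
    show "f t - f t0 = g t * d t"
      using 1 2 by (cases "d t = 0") (auto simp: g_def)
    show "norm (g t) \<le> M"
    proof (cases "d t = 0")
      case False
      have "M * \<bar>v\<bar> \<le> M * norm (d t)"
        using 2 M by (intro mult_left_mono) auto
      then show ?thesis
        using 1 False by (simp add: g_def norm_divide field_simps)
    qed (use M in \<open>simp add: g_def\<close>)
  qed
  define h where "h = (\<lambda>k. ?I (\<lambda>t. g t * fmode (- k) t))"
  have M: "M \<ge> 0"
    using gB[of 0] norm_ge_zero order_trans by blast
  have ig: "integrable unit_interval (\<lambda>t. a * (g t * fmode k t))" for a k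
    using gB M by (intro integrable_unit_interval[of _ "norm a * M"]) (auto simp: norm_mult intro!: mult_mono)
  have fB: "norm (f t) \<le> norm (f t0) + 2 * M" for t
  proof -
    have "norm (d t) \<le> 2"
      unfolding d_def by (rule order_trans[OF norm_triangle_ineq4]) simp
    then have "norm (g t * d t) \<le> M * 2"
      unfolding norm_mult using gB[of t] M by (intro mult_mono) auto
    moreover have "f t = f t0 + g t * d t"
      using gd[of t] by (simp add: algebra_simps)
    ultimately show ?thesis
      using norm_triangle_ineq[of "f t0" "g t * d t"] by simp
  qed
  have coeff': "?I (\<lambda>t. f t * fmode (- k) t) = c k" for k
  proof -
    have "integrable unit_interval (\<lambda>t. f t * fmode (- k) t)"
      using fB by (intro integrable_unit_interval[of _ "norm (f t0) + 2 * M"]) (auto simp: norm_mult)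
    then show ?thesis
      using coeff[of k] by (subst lebesgue_integral_eq_integral) (auto simp: integral_unique)
  qed
  \<comment> \<open>Multiplication by \<open>d\<close> combines the frequencies k - 1 and k of g, so
    each coefficient of f - f t0 is a difference of neighbouring coefficients of g. The constant f
    t0 contributes to k = 0 alone.\<close>
  have rec: "c k * fmode k t0 - (if k = 0 then f t0 else 0) = h (k - 1) * fmode (k - 1) t0 - h k * fmode k t0" for k
  proof -
    have eq: "f t * fmode (- k) t - f t0 * fmode (- k) t
       = fmode (-1) t0 * (g t * fmode (- (k - 1)) t) - 1 * (g t * fmode (- k) t)" for t
    proof -
      have "f t * fmode (- k) t - f t0 * fmode (- k) t = (f t - f t0) * fmode (- k) t"
        by (simp add: algebra_simps)
      also have "\<dots> = g t * d t * fmode (- k) t"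
        by (simp only: gd)
      also have "d t = fmode 1 t * fmode (- 1) t0 - 1"
        unfolding d_def diff_conv_add_uminus fmode_add_right fmode_minus_right ..
      also have "fmode (- k) t * fmode 1 t = fmode (- (k - 1)) t"
        by (simp add: fmode_add[symmetric])
      then have "g t * (fmode 1 t * fmode (- 1) t0 - 1) * fmode (- k) t =
        fmode (-1) t0 * (g t * fmode (- (k - 1)) t) - 1 * (g t * fmode (- k) t)"
        by (simp add: algebra_simps)
      finally show ?thesis .
    qed
    have if1: "integrable unit_interval (\<lambda>t. f t * fmode (- k) t)"
      using fB by (intro integrable_unit_interval[of _ "norm (f t0) + 2 * M"]) (auto simp: norm_mult)
    have if2: "integrable unit_interval (\<lambda>t. f t0 * fmode (- k) t)"
      by (intro integrable_unit_interval[of _ "norm (f t0)"]) (auto simp: norm_mult)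
    have "c k - (if k = 0 then f t0 else 0) = ?I (\<lambda>t. f t * fmode (- k) t - f t0 * fmode (- k) t)"
      using if1 if2 by (simp add: coeff' integral_fmode)
    also have "\<dots> = fmode (-1) t0 * h (k - 1) - h k"
      unfolding eq by (subst Bochner_Integration.integral_diff[OF ig ig]) (simp add: h_def)
    finally have "(c k - (if k = 0 then f t0 else 0)) * fmode k t0 = (fmode (-1) t0 * h (k - 1) - h k) * fmode k t0"
      by simp
    moreover have "fmode (k - 1) t0 = fmode (-1) t0 * fmode k t0"
      by (simp add: fmode_add[symmetric])
    ultimately show ?thesis
      by (auto simp: algebra_simps split: if_splits)
  qed
  \<comment> \<open>Restricting to n > 0 guarantees that the window contains k = 0, the index that
    supplies f t0.\<close>
  have tel: "(\<Sum>k\<in>{- int n..<int n}. c k * fmode k t0) = f t0 + h (- int n - 1) * fmode (- int n - 1) t0 - h (int n - 1) * fmode (int n - 1) t0"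
    if "n > 0" for n :: nat
    using that
  proof (induction n rule: nat_induct_non_zero)
    case 1
    have "{- 1..<1} = {- 1, 0 :: int}" by auto
    then have "(\<Sum>k\<in>{- int 1..<int 1}. c k * fmode k t0) = (c 0 * fmode 0 t0 - f t0) + c (- 1) * fmode (- 1) t0 + f t0"
      by simp
    also have "c 0 * fmode 0 t0 - f t0 = h (- 1) * fmode (- 1) t0 - h 0"
      using rec[of 0] by simp
    finally show ?case using rec[of "-1"] by simp
  next
    case (Suc n)
    have "{- int (Suc n)..<int (Suc n)} = insert (- int n - 1) (insert (int n) {- int n..<int n})" by auto
    then have "(\<Sum>k\<in>{- int (Suc n)..<int (Suc n)}. c k * fmode k t0)
        = c (- int n - 1) * fmode (- int n - 1) t0 + (c (int n) * fmode (int n) t0 + (\<Sum>k\<in>{- int n..<int n}. c k * fmode k t0))"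
      by simp
    also have "c (- int n - 1) * fmode (- int n - 1) t0
        = h (- int n - 1 - 1) * fmode (- int n - 1 - 1) t0 - h (- int n - 1) * fmode (- int n - 1) t0"
      using rec[of "- int n - 1"] by simp
    also have "c (int n) * fmode (int n) t0 = h (int n - 1) * fmode (int n - 1) t0 - h (int n) * fmode (int n) t0"
      using rec[of "int n"] \<open>n > 0\<close> by simp
    also note Suc.IH
    finally show ?case
      by (simp add: algebra_simps)
  qed
  have "(\<lambda>n. \<Sum>k\<in>{- int n..<int n}. c k * fmode k t0) \<longlonglongrightarrow> f t0"
  proof (rule Lim_transform_eventually)
    have "(\<lambda>n. h (- int n - 1)) \<longlonglongrightarrow> 0"
      unfolding h_def by (rule riemann_lebesgue[OF _ gB]) (auto simp: inj_def)
    then have 1: "(\<lambda>n. h (- int n - 1) * fmode (- int n - 1) t0) \<longlonglongrightarrow> 0"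
      by (rule Lim_null_comparison[rotated, OF tendsto_norm_zero]) (auto simp: norm_mult)
    have "(\<lambda>n. h (int n - 1)) \<longlonglongrightarrow> 0"
      unfolding h_def by (rule riemann_lebesgue[OF _ gB]) (auto simp: inj_def)
    then have 2: "(\<lambda>n. h (int n - 1) * fmode (int n - 1) t0) \<longlonglongrightarrow> 0"
      by (rule Lim_null_comparison[rotated, OF tendsto_norm_zero]) (auto simp: norm_mult)
    show "(\<lambda>n. f t0 + h (- int n - 1) * fmode (- int n - 1) t0 - h (int n - 1) * fmode (int n - 1) t0) \<longlonglongrightarrow> f t0"
      using tendsto_diff[OF tendsto_add[OF tendsto_const 1] 2] by simp
    show "\<forall>\<^sub>F n in sequentially. f t0 + h (- int n - 1) * fmode (- int n - 1) t0 - h (int n - 1) * fmode (int n - 1) t0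
        = (\<Sum>k\<in>{- int n..<int n}. c k * fmode k t0)"
      using eventually_gt_at_top[of 0] by eventually_elim (simp only: tel)
  qed
  \<comment> \<open>Telescoping yields only the limit of the symmetric partial sums; absolute
    summability of the coefficients upgrades it to an unordered sum with the same value.\<close>
  moreover have sum: "(\<lambda>k. c k * fmode k t0) summable_on UNIV"
    by (rule abs_summable_summable) (use summ in \<open>simp add: norm_mult\<close>)
  ultimately show ?thesis
    using has_sum_int_symmetric_partial_sums LIMSEQ_unique has_sum_infsum by metis
qed

section \<open>The periodized theta kernel and its Fourier series\<close>

lemma vector_derivative_lipschitz:
  fixes f :: "real \<Rightarrow> 'a :: real_normed_vector"
  assumes "\<And>u. u \<in> closed_segment x y \<Longrightarrow> (f has_vector_derivative f' u) (at u)"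
    and "\<And>u. u \<in> closed_segment x y \<Longrightarrow> norm (f' u) \<le> B"
  shows "norm (f x - f y) \<le> B * \<bar>x - y\<bar>"
proof -
  have "norm (f x - f y) \<le> B * norm (x - y)"
  proof (rule differentiable_bound[where S = "closed_segment x y"])
    fix u assume u: "u \<in> closed_segment x y"
    show "(f has_derivative (\<lambda>h. h *\<^sub>R f' u)) (at u within closed_segment x y)"
      using assms(1)[OF u] by (auto simp: has_vector_derivative_def intro: has_derivative_at_withinI)
    show "onorm (\<lambda>h. h *\<^sub>R f' u) \<le> B"
      using mult_right_mono[OF assms(2)[OF u], of "\<bar>h\<bar>" for h :: real]
      by (intro onorm_le) (simp add: mult.commute)
  qed auto
  then show ?thesis by simp
qed

section \<open>Series over the integers with exponentially decaying terms\<close>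

lemma summable_on_intI:
  fixes f :: "int \<Rightarrow> real"
  assumes "(\<lambda>n. f (int n)) summable_on UNIV" "(\<lambda>n. f (- int n)) summable_on UNIV"
  shows "f summable_on UNIV"
proof -
  have "f summable_on range int"
    using assms(1) by (subst summable_on_reindex) (auto simp: o_def)
  moreover have "f summable_on range (\<lambda>n. - int n)"
    using assms(2) by (subst summable_on_reindex) (auto simp: o_def inj_def)
  moreover have "range int \<union> range (\<lambda>n. - int n) = UNIV"
  proof (rule sym[OF UNIV_eq_I])
    fix k :: int
    show "k \<in> range int \<union> range (\<lambda>n. - int n)"
      by (cases k rule: int_cases2) auto
  qed
  ultimately show ?thesis
    by (metis summable_on_union)
qed

lemma summable_on_exp_abs:
  assumes "(d :: real) > 0"
  shows "(\<lambda>j::int. exp (- d * \<bar>of_int j\<bar>)) summable_on UNIV"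
proof -
  have "summable (\<lambda>n. exp (- d) ^ n)"
    by (rule summable_geometric) (use assms in simp)
  also have "(\<lambda>n. exp (- d) ^ n) = (\<lambda>n. exp (- d * real n))"
    by (simp add: exp_of_nat_mult[symmetric] mult.commute)
  finally have "(\<lambda>n. exp (- d * real n)) summable_on UNIV"
    by (intro summable_nonneg_imp_summable_on) auto
  then show ?thesis
    by (intro summable_on_intI) auto
qed

text \<open>The constant must not depend on t. Reindexing j by the floor of t reduces to a shift in
  [0, 1), which costs a factor \<open>exp d\<close>.\<close>

lemma summable_on_exp_abs_shift:
  assumes "(d :: real) > 0"
  obtains C where "\<And>t :: real. (\<lambda>j::int. exp (- d * \<bar>t + of_int j\<bar>)) summable_on UNIV"
    and "\<And>t :: real. (\<Sum>\<^sub>\<infinity>j::int. exp (- d * \<bar>t + of_int j\<bar>)) \<le> C"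
proof -
  define C where "C = exp d * (\<Sum>\<^sub>\<infinity>j::int. exp (- d * \<bar>of_int j\<bar>))"
  have "(\<lambda>j::int. exp (- d * \<bar>t + of_int j\<bar>)) summable_on UNIV \<and>
      (\<Sum>\<^sub>\<infinity>j::int. exp (- d * \<bar>t + of_int j\<bar>)) \<le> C" for t :: real
  proof -
    have bij: "bij_betw (\<lambda>j. j + \<lfloor>t\<rfloor>) UNIV UNIV"
      by (rule bij_betwI[where g = "\<lambda>j. j - \<lfloor>t\<rfloor>"]) auto
    have le: "exp (- d * \<bar>t + of_int j\<bar>) \<le> exp d * exp (- d * \<bar>of_int (j + \<lfloor>t\<rfloor>)\<bar>)" for j
    proof -
      have "\<bar>of_int (j + \<lfloor>t\<rfloor>)\<bar> \<le> \<bar>t + of_int j\<bar> + 1"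
        using of_int_floor_le[of t] real_of_int_floor_add_one_gt[of t] unfolding of_int_add by linarith
      then have "d * \<bar>of_int (j + \<lfloor>t\<rfloor>)\<bar> \<le> d * (\<bar>t + of_int j\<bar> + 1)"
        using assms by (intro mult_left_mono) auto
      then show ?thesis
        by (simp add: exp_add[symmetric] algebra_simps)
    qed
    have s: "(\<lambda>j. exp d * exp (- d * \<bar>real_of_int (j + \<lfloor>t\<rfloor>)\<bar>)) summable_on UNIV"
      using summable_on_reindex_bij_betw[OF bij, of "\<lambda>j. exp (- d * \<bar>of_int j\<bar>)"] summable_on_exp_abs[OF assms]
      by (intro summable_on_cmult_right) simp
    have s': "(\<lambda>j::int. exp (- d * \<bar>t + of_int j\<bar>)) summable_on UNIV"
      by (rule summable_on_comparison_test[OF s]) (use le in auto)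
    have "(\<Sum>\<^sub>\<infinity>j::int. exp (- d * \<bar>t + of_int j\<bar>)) \<le> (\<Sum>\<^sub>\<infinity>j. exp d * exp (- d * \<bar>real_of_int (j + \<lfloor>t\<rfloor>)\<bar>))"
      by (rule infsum_mono[OF s' s le])
    also have "\<dots> = C"
      unfolding C_def infsum_cmult_right' 
      using infsum_reindex_bij_betw[OF bij, of "\<lambda>j. exp (- d * \<bar>of_int j\<bar>)"] by simp
    finally show ?thesis
      using s' by simp
  qed
  then show ?thesis
    using that by blast
qed

text \<open>With x = \<open>exp (L * u)\<close> this is x^z e^{-x}, the Mellin integrand of Gamma
  with respect to dx / x. For L = ln b, multiplication of x by b is translation of u by 1.\<close>

definition theta_kernel :: "complex \<Rightarrow> real \<Rightarrow> real \<Rightarrow> complex" where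
  "theta_kernel z L u = exp (z * of_real (L * u) - of_real (exp (L * u)))"

lemma norm_theta_kernel: "norm (theta_kernel z L u) = exp (Re z * (L * u) - exp (L * u))"
  by (simp add: theta_kernel_def norm_exp_eq_Re)

text \<open>For u < 0 the factor \<open>exp (a * (L * u))\<close> decays by itself. For u \<ge> 0,
  put X = L u: the double exponential dominates X^2 / 2, and completing the square in 2 a X - X^2 /
  2 produces the constant 2 a^2.\<close>

lemma theta_kernel_decay:
  fixes a L u :: real
  assumes "a > 0" "L > 0"
  shows "exp (a * (L * u) - exp (L * u)) \<le> exp (2 * a\<^sup>2) * exp (- (a * L) * \<bar>u\<bar>)"
proof (cases "u \<ge> 0")
  case True
  define X where "X = L * u"
  have X: "X \<ge> 0"
    using True assms by (simp add: X_def zero_le_mult_iff)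
  have "0 \<le> (X - 2 * a)\<^sup>2"
    by simp
  then have "2 * a * X - X\<^sup>2 / 2 \<le> 2 * a\<^sup>2"
    by (simp add: power2_eq_square algebra_simps)
  moreover have "X\<^sup>2 / 2 \<le> exp X"
    using exp_lower_Taylor_quadratic[OF X] X by simp
  ultimately have "a * X - exp X \<le> 2 * a\<^sup>2 - a * X"
    by linarith
  then show ?thesis
    using True by (simp add: X_def exp_add[symmetric] mult.assoc)
next
  case False
  have "a * (L * u) - exp (L * u) \<le> 2 * a\<^sup>2 + (- (a * L) * \<bar>u\<bar>)"
    using False by (simp add: mult.assoc add_increasing)
  then show ?thesis
    by (simp add: exp_add[symmetric])
qed

lemma has_vector_derivative_theta_kernel:
  "(theta_kernel z L has_vector_derivative
     (of_real L * (z - of_real (exp (L * u))) * theta_kernel z L u)) (at u within S)"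
proof -
  have "((\<lambda>u. z * of_real (L * u) - of_real (exp (L * u))) has_vector_derivative
      (z * of_real (L * 1) - of_real (exp (L * u) * (L * 1)))) (at u within S)"
    by (intro has_vector_derivative_diff has_vector_derivative_mult_right has_vector_derivative_of_real
        has_real_derivative_iff_has_vector_derivative[THEN iffD1] derivative_eq_intros) auto
  then have "((exp \<circ> (\<lambda>u. z * of_real (L * u) - of_real (exp (L * u)))) has_vector_derivative
      (z * of_real (L * 1) - of_real (exp (L * u) * (L * 1))) * theta_kernel z L u) (at u within S)"
    unfolding theta_kernel_def by (rule field_vector_diff_chain_within) (rule DERIV_subset[OF DERIV_exp], simp)
  then show ?thesis
    by (simp add: theta_kernel_def[abs_def] o_def algebra_simps)
qed

text \<open>The local Lipschitz constant has to decay in x, so that the constants of all translates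
  can be added. The derivative combines kernels with real exponents \<open>Re z\<close> and
  \<open>Re z + 1\<close>, and both are bounded by the slower of the two decay rates. The factor
  \<open>exp (Re z * L)\<close> in the witness pays for moving the bound from an intermediate point
  u to x, where |x| \<le> |u| + 1.\<close>

lemma theta_kernel_lipschitz:
  assumes z: "Re z > 0" and L: "L > 0"
  obtains K where "\<And>x y. \<bar>x - y\<bar> \<le> 1 \<Longrightarrow>
    norm (theta_kernel z L x - theta_kernel z L y) \<le> K * exp (- (Re z * L) * \<bar>x\<bar>) * \<bar>x - y\<bar>"
proof -
  let ?a = "Re z"
  define K1 where "K1 = L * (norm z * exp (2 * ?a\<^sup>2) + exp (2 * (?a + 1)\<^sup>2))"
  have deriv_bound: "norm (of_real L * (z - of_real (exp (L * u))) * theta_kernel z L u) \<le> K1 * exp (- (?a * L) * \<bar>u\<bar>)" for u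
  proof -
    have "norm (of_real L * (z - of_real (exp (L * u))) * theta_kernel z L u)
        \<le> L * ((norm z + exp (L * u)) * norm (theta_kernel z L u))"
    proof -
      have "norm (z - of_real (exp (L * u))) \<le> norm z + exp (L * u)"
        using norm_triangle_ineq4[of z "of_real (exp (L * u))"] by (simp only: norm_of_real abs_exp_cancel)
      then have "L * (norm (z - of_real (exp (L * u))) * norm (theta_kernel z L u))
          \<le> L * ((norm z + exp (L * u)) * norm (theta_kernel z L u))"
        using L by (intro mult_left_mono mult_right_mono) auto
      then show ?thesis
        using L by (simp only: norm_mult norm_of_real abs_of_pos mult.assoc)
    qed
    also have "\<dots> = L * (norm z * exp (?a * (L * u) - exp (L * u)) + exp ((?a + 1) * (L * u) - exp (L * u)))"
      by (simp add: norm_theta_kernel exp_add[symmetric] algebra_simps)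
    also have "\<dots> \<le> L * (norm z * (exp (2 * ?a\<^sup>2) * exp (- (?a * L) * \<bar>u\<bar>))
       + exp (2 * (?a + 1)\<^sup>2) * exp (- (?a * L) * \<bar>u\<bar>))"
    proof (intro mult_left_mono add_mono)
      have "exp ((?a + 1) * (L * u) - exp (L * u)) \<le> exp (2 * (?a + 1)\<^sup>2) * exp (- ((?a + 1) * L) * \<bar>u\<bar>)"
        using z L by (intro theta_kernel_decay) auto
      also have "exp (- ((?a + 1) * L) * \<bar>u\<bar>) \<le> exp (- (?a * L) * \<bar>u\<bar>)"
        using L by (simp add: algebra_simps)
      finally show "exp ((?a + 1) * (L * u) - exp (L * u)) \<le> exp (2 * (?a + 1)\<^sup>2) * exp (- (?a * L) * \<bar>u\<bar>)"
        by simp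
    qed (use L theta_kernel_decay[OF z L] in auto)
    finally show ?thesis
      by (simp add: K1_def algebra_simps)
  qed
  have K1: "K1 \<ge> 0"
    using L by (simp add: K1_def)
  show ?thesis
  proof (rule that)
    fix x y :: real assume xy: "\<bar>x - y\<bar> \<le> 1"
    show "norm (theta_kernel z L x - theta_kernel z L y) \<le> (K1 * exp (?a * L)) * exp (- (?a * L) * \<bar>x\<bar>) * \<bar>x - y\<bar>"
    proof (rule vector_derivative_lipschitz[OF has_vector_derivative_theta_kernel])
      fix u assume "u \<in> closed_segment x y"
      then have "\<bar>x\<bar> \<le> \<bar>u\<bar> + 1"
        using xy by (auto simp: closed_segment_eq_real_ivl split: if_splits)
      then have "?a * L * \<bar>x\<bar> \<le> ?a * L * (\<bar>u\<bar> + 1)"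
        using z L by (intro mult_left_mono) auto
      then have "exp (- (?a * L) * \<bar>u\<bar>) \<le> exp (?a * L) * exp (- (?a * L) * \<bar>x\<bar>)"
        by (simp add: exp_add[symmetric] algebra_simps)
      then have "K1 * exp (- (?a * L) * \<bar>u\<bar>) \<le> K1 * (exp (?a * L) * exp (- (?a * L) * \<bar>x\<bar>))"
        by (intro mult_left_mono K1)
      with deriv_bound[of u] show "norm (of_real L * (z - of_real (exp (L * u))) * theta_kernel z L u)
          \<le> (K1 * exp (?a * L)) * exp (- (?a * L) * \<bar>x\<bar>)"
        unfolding mult.assoc by linarith
    qed
  qed
qed

definition theta_sum :: "complex \<Rightarrow> real \<Rightarrow> real \<Rightarrow> complex" where
  "theta_sum z L t = (\<Sum>\<^sub>\<infinity>j::int. theta_kernel z L (t + of_int j))"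

text \<open>Uniformity of C in t matters: the periodized kernel is later evaluated at infinitely
  many different shifts inside one double sum.\<close>

lemma theta_kernel_summable_bound:
  assumes z: "Re z > 0" and L: "L > 0"
  obtains C where "\<And>t. (\<lambda>j::int. norm (theta_kernel z L (t + of_int j))) summable_on UNIV"
    and "\<And>t. (\<Sum>\<^sub>\<infinity>j::int. norm (theta_kernel z L (t + of_int j))) \<le> C"
proof -
  let ?d = "Re z * L"
  have "?d > 0" using z L by simp
  then obtain C where C: "\<And>t. (\<lambda>j::int. exp (- ?d * \<bar>t + of_int j\<bar>)) summable_on UNIV"
      "\<And>t. (\<Sum>\<^sub>\<infinity>j::int. exp (- ?d * \<bar>t + of_int j\<bar>)) \<le> C"
    using summable_on_exp_abs_shift by blast
  have le: "norm (theta_kernel z L (t + of_int j)) \<le> exp (2 * (Re z)\<^sup>2) * exp (- ?d * \<bar>t + of_int j\<bar>)" for t j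
    unfolding norm_theta_kernel using z L by (rule theta_kernel_decay)
  have s: "(\<lambda>j::int. exp (2 * (Re z)\<^sup>2) * exp (- ?d * \<bar>t + of_int j\<bar>)) summable_on UNIV" for t
    by (intro summable_on_cmult_right C)
  have s': "(\<lambda>j::int. norm (theta_kernel z L (t + of_int j))) summable_on UNIV" for t
    by (rule summable_on_comparison_test[OF s]) (use le in auto)
  show ?thesis
  proof (rule that[OF s'])
    fix t
    have "(\<Sum>\<^sub>\<infinity>j::int. norm (theta_kernel z L (t + of_int j))) \<le> (\<Sum>\<^sub>\<infinity>j::int. exp (2 * (Re z)\<^sup>2) * exp (- ?d * \<bar>t + of_int j\<bar>))"
      by (rule infsum_mono[OF s' s le])
    also have "\<dots> \<le> exp (2 * (Re z)\<^sup>2) * C"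
      unfolding infsum_cmult_right' by (intro mult_left_mono C) auto
    finally show "(\<Sum>\<^sub>\<infinity>j::int. norm (theta_kernel z L (t + of_int j))) \<le> exp (2 * (Re z)\<^sup>2) * C" .
  qed
qed

lemma theta_kernel_summable:
  assumes "Re z > 0" "L > 0"
  shows "(\<lambda>j::int. theta_kernel z L (t + of_int j)) summable_on UNIV"
proof (rule theta_kernel_summable_bound[OF assms])
  assume "\<And>t. (\<lambda>j::int. norm (theta_kernel z L (t + of_int j))) summable_on UNIV"
  then show ?thesis
    by (rule abs_summable_summable)
qed

lemma theta_sum_periodic: "theta_sum z L (t + 1) = theta_sum z L t"
proof -
  have bij: "bij_betw (\<lambda>j::int. j + 1) UNIV UNIV"
    by (rule bij_betwI[where g = "\<lambda>j. j - 1"]) auto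
  show ?thesis
    unfolding theta_sum_def
    using infsum_reindex_bij_betw[OF bij, of "\<lambda>j. theta_kernel z L (t + of_int j)"] by (simp add: algebra_simps)
qed

lemma theta_sum_lipschitz:
  assumes z: "Re z > 0" and L: "L > 0"
  obtains M where "\<And>x y. \<bar>x - y\<bar> \<le> 1 \<Longrightarrow> norm (theta_sum z L x - theta_sum z L y) \<le> M * \<bar>x - y\<bar>"
proof -
  let ?d = "Re z * L"
  have "?d > 0" using z L by simp
  then obtain C where C: "\<And>t. (\<lambda>j::int. exp (- ?d * \<bar>t + of_int j\<bar>)) summable_on UNIV"
      "\<And>t. (\<Sum>\<^sub>\<infinity>j::int. exp (- ?d * \<bar>t + of_int j\<bar>)) \<le> C"
    using summable_on_exp_abs_shift by blast
  obtain K where K: "\<And>x y. \<bar>x - y\<bar> \<le> 1 \<Longrightarrow>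
    norm (theta_kernel z L x - theta_kernel z L y) \<le> K * exp (- ?d * \<bar>x\<bar>) * \<bar>x - y\<bar>"
    using theta_kernel_lipschitz[OF z L] by blast
  have K0: "K \<ge> 0"
  proof -
    have "0 \<le> norm (theta_kernel z L 0 - theta_kernel z L 1)"
      by (rule norm_ge_zero)
    also have "\<dots> \<le> K * exp (- ?d * \<bar>0\<bar>) * \<bar>0 - 1\<bar>"
      by (rule K) simp
    finally show ?thesis by simp
  qed
  show ?thesis
  proof (rule that)
    fix x y :: real assume xy: "\<bar>x - y\<bar> \<le> 1"
    have "norm (theta_sum z L x - theta_sum z L y)
        \<le> (\<Sum>\<^sub>\<infinity>j::int. (K * \<bar>x - y\<bar>) * exp (- ?d * \<bar>x + of_int j\<bar>))"
    proof (rule norm_infsum_le)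
      show "((\<lambda>j::int. theta_kernel z L (x + of_int j) - theta_kernel z L (y + of_int j)) has_sum (theta_sum z L x - theta_sum z L y)) UNIV"
        unfolding theta_sum_def diff_conv_add_uminus
        by (rule has_sum_add[OF has_sum_infsum has_sum_uminusI[OF has_sum_infsum]])
           (rule theta_kernel_summable[OF z L])+
      show "((\<lambda>j::int. (K * \<bar>x - y\<bar>) * exp (- ?d * \<bar>x + of_int j\<bar>)) has_sum
          (\<Sum>\<^sub>\<infinity>j::int. (K * \<bar>x - y\<bar>) * exp (- ?d * \<bar>x + of_int j\<bar>))) UNIV"
        by (intro has_sum_infsum summable_on_cmult_right C)
      show "norm (theta_kernel z L (x + of_int j) - theta_kernel z L (y + of_int j))
          \<le> (K * \<bar>x - y\<bar>) * exp (- ?d * \<bar>x + of_int j\<bar>)" for j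
        using K[of "x + of_int j" "y + of_int j"] xy by (simp add: mult_ac)
    qed
    also have "\<dots> \<le> (K * \<bar>x - y\<bar>) * C"
      unfolding infsum_cmult_right' using K0 by (intro mult_left_mono C) auto
    finally show "norm (theta_sum z L x - theta_sum z L y) \<le> (K * C) * \<bar>x - y\<bar>"
      by (simp add: mult_ac)
  qed
qed

section \<open>Means of the theta sum as Mellin integrals of e^{-x}\<close>

lemma integral_theta_kernel:
  assumes L: "L > 0" and z: "Re z > 0" and ab: "a \<le> b"
  shows "(theta_kernel z L has_integral
    integral {exp (L * a)..exp (L * b)} (\<lambda>x. of_real x powr (z - 1) / of_real (exp x)) / of_real L) {a..b}"
proof -
  let ?f = "\<lambda>x. complex_of_real x powr (z - 1) / of_real (exp x)"
  \<comment> \<open>Substitution x = exp (L u): the Jacobian L x supplies the missing power of x and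
    the final division by L.\<close>
  have "((\<lambda>u. (exp (L * u) * L) *\<^sub>R ?f (exp (L * u))) has_integral integral {exp (L * a)..exp (L * b)} ?f) {a..b}"
  proof (rule has_integral_substitution)
    show "(\<lambda>u. exp (L * u)) ` {a..b} \<subseteq> {exp (L * a)..exp (L * b)}"
      using L by auto
    show "continuous_on {exp (L * a)..exp (L * b)} ?f"
      by (intro continuous_intros) (auto intro: order_less_le_trans[OF exp_gt_zero] order_trans[OF exp_ge_zero])
    show "((\<lambda>u. exp (L * u)) has_real_derivative exp (L * u) * L) (at u within {a..b})" for u
      by (auto intro!: derivative_eq_intros)
  qed (use L ab in auto)
  also have "(\<lambda>u. (exp (L * u) * L) *\<^sub>R ?f (exp (L * u))) = (\<lambda>u. of_real L * theta_kernel z L u)"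
  proof
    fix u
    have "of_real (exp (L * u)) powr (z - 1) = exp ((z - 1) * of_real (L * u))"
      by (simp add: powr_def Ln_of_real)
    then show "(exp (L * u) * L) *\<^sub>R ?f (exp (L * u)) = of_real L * theta_kernel z L u"
      by (simp add: theta_kernel_def scaleR_conv_of_real exp_diff exp_of_real[symmetric] algebra_simps)
  qed
  finally have "((\<lambda>u. of_real L * theta_kernel z L u / of_real L) has_integral
      integral {exp (L * a)..exp (L * b)} ?f / of_real L) {a..b}"
    by (rule has_integral_divide)
  then show ?thesis
    using L by simp
qed

text \<open>Dominated convergence with the Gamma integrand as its own majorant. The geometric
  cut-offs are the images of [-n, n] under u -> exp (L u), so they fit sums over integer
  cells.\<close>

lemma Gamma_truncated_limit:
  assumes L: "L > 0" and z: "Re z > 0"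
  shows "(\<lambda>n. integral {exp (- L * real n)..exp (L * real n)} (\<lambda>x. of_real x powr (z - 1) / of_real (exp x))) \<longlonglongrightarrow> Gamma z"
proof -
  let ?f = "\<lambda>x. complex_of_real x powr (z - 1) / of_real (exp x)"
  have abs: "?f absolutely_integrable_on {0<..}"
    by (rule absolutely_integrable_Gamma_integral'[OF z])
  have sub: "{exp (- L * real n)..exp (L * real n)} \<inter> {0<..} = {exp (- L * real n)..exp (L * real n)}" for n
    by (auto intro: order_less_le_trans[OF exp_gt_zero] order_trans[OF exp_ge_zero])
  have "(\<lambda>n. integral {0<..} (\<lambda>x. if x \<in> {exp (- L * real n)..exp (L * real n)} then ?f x else 0))
      \<longlonglongrightarrow> integral {0<..} ?f"
  proof (rule dominated_convergence)
    show "(\<lambda>x. if x \<in> {exp (- L * real n)..exp (L * real n)} then ?f x else 0) integrable_on {0<..}" for n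
      unfolding integrable_restrict_Int sub
      by (intro integrable_continuous_real continuous_intros) (auto intro: order_less_le_trans[OF exp_gt_zero] order_trans[OF exp_ge_zero])
    show "(\<lambda>x. norm (?f x)) integrable_on {0<..}"
      using abs by (simp add: absolutely_integrable_on_def)
    show "(\<lambda>n. if x \<in> {exp (- L * real n)..exp (L * real n)} then ?f x else 0) \<longlonglongrightarrow> ?f x" if "x \<in> {0<..}" for x
    proof (rule tendsto_eventually)
      have "\<forall>\<^sub>F n in sequentially. real n \<ge> \<bar>ln x\<bar> / L"
        using eventually_ge_at_top[of "nat \<lceil>\<bar>ln x\<bar> / L\<rceil>"] by eventually_elim linarith
      then show "\<forall>\<^sub>F n in sequentially. (if x \<in> {exp (- L * real n)..exp (L * real n)} then ?f x else 0) = ?f x"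
      proof eventually_elim
        case (elim n)
        then have "\<bar>ln x\<bar> \<le> L * real n"
          using L by (simp add: field_simps)
        then have "exp (- L * real n) \<le> exp (ln x)" "exp (ln x) \<le> exp (L * real n)"
          by auto
        moreover have "exp (ln x) = x"
          using that by simp
        ultimately show ?case
          by simp
      qed
    qed
  qed auto
  then show ?thesis
    unfolding integral_restrict_Int sub using Gamma_integral_complex'[OF z] by (simp add: integral_unique)
qed

text \<open>Unfolding: the integral of a periodization over one period is the integral of the kernel
  over the whole line, which is the Mellin integral of Gamma up to the factor 1 / L.\<close>

lemma has_integral_theta_sum:
  assumes L: "L > 0" and z: "Re z > 0"
  shows "(theta_sum z L has_integral Gamma z / of_real L) {0..1}"
proof -
  let ?d = "Re z * L"
  let ?f = "\<lambda>x. complex_of_real x powr (z - 1) / of_real (exp x)"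
  let ?F = "finite_subsets_at_top (UNIV :: int set)"
  have d: "?d > 0"
    using z L by simp
  have bound: "norm (theta_kernel z L (t + of_int j)) \<le> exp (2 * (Re z)\<^sup>2) * (exp ?d * exp (- ?d * \<bar>of_int j\<bar>))"
    if "t \<in> {0..1}" for t j
  proof -
    have "?d * \<bar>of_int j\<bar> \<le> ?d * (\<bar>t + of_int j\<bar> + 1)"
      using that d by (intro mult_left_mono) auto
    then have "exp (- ?d * \<bar>t + of_int j\<bar>) \<le> exp ?d * exp (- ?d * \<bar>of_int j\<bar>)"
      by (simp add: exp_add[symmetric] algebra_simps)
    then show ?thesis
      unfolding norm_theta_kernel
      by (intro order_trans[OF theta_kernel_decay[OF z L]] mult_left_mono) auto
  qed
  \<comment> \<open>Convergence is taken along finite sets of integers, uniformly on the period, so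
    integrating term by term directly yields a \<open>has_sum\<close> statement for the cell
    integrals.\<close>
  have lim: "uniform_limit {0..1} (\<lambda>X t. \<Sum>j\<in>X. theta_kernel z L (t + of_int j)) (theta_sum z L) ?F"
    unfolding theta_sum_def[abs_def]
    by (rule Weierstrass_m_test_general[OF bound]) (assumption, intro summable_on_cmult_right summable_on_exp_abs d)
  have cont: "continuous_on {0..1} (\<lambda>t. \<Sum>j\<in>X. theta_kernel z L (t + of_int j))" for X
    unfolding theta_kernel_def by (intro continuous_intros)
  obtain I J where I: "\<And>X. ((\<lambda>t. \<Sum>j\<in>X. theta_kernel z L (t + of_int j)) has_integral I X) {0..1}"
    and J: "(theta_sum z L has_integral J) {0..1}" and IJ: "(I \<longlongrightarrow> J) ?F"
    by (rule uniform_limit_integral[OF lim cont]) auto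
  define i where "i = (\<lambda>j. integral {exp (L * of_int j)..exp (L * of_int (j + 1))} ?f / of_real L)"
  have i: "((\<lambda>t. theta_kernel z L (t + of_int j)) has_integral i j) {0..1}" for j
  proof -
    have "(theta_kernel z L has_integral i j) (cbox (of_int j) (of_int (j + 1)))"
      unfolding i_def using integral_theta_kernel[OF L z, of "of_int j" "of_int (j + 1)"] by simp
    from has_integral_affinity[OF this, of 1 "of_int j"] show ?thesis
      by (simp add: image_affinity_cbox)
  qed
  have "sum i X = I X" if "finite X" for X
    by (rule has_integral_unique[OF has_integral_sum[OF that i] I])
  then have "(i has_sum J) UNIV"
    unfolding has_sum_def
    by (intro Lim_transform_eventually[OF IJ] eventually_finite_subsets_at_top_weakI) simp
  then have "(\<lambda>n. \<Sum>j\<in>{- int n..<int n}. i j) \<longlonglongrightarrow> J"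
    by (rule has_sum_int_symmetric_partial_sums)
  \<comment> \<open>Each induction step glues one cell to the left end and one to the right end of
    the interval.\<close>
  moreover have "(\<Sum>j\<in>{- int n..<int n}. i j) = integral {exp (- L * real n)..exp (L * real n)} ?f / of_real L" for n
  proof (induction n)
    case (Suc n)
    have intf: "?f integrable_on {exp a..exp b}" for a b
      by (intro integrable_continuous_real continuous_intros) (auto intro: order_less_le_trans[OF exp_gt_zero] order_trans[OF exp_ge_zero])
    have "{- int (Suc n)..<int (Suc n)} = insert (- int n - 1) (insert (int n) {- int n..<int n})" by auto
    then have "(\<Sum>j\<in>{- int (Suc n)..<int (Suc n)}. i j) = i (- int n - 1) + (\<Sum>j\<in>{- int n..<int n}. i j) + i (int n)"
      by simp
    also have "\<dots> = (integral {exp (L * (- real n - 1))..exp (- L * real n)} ?f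
       + integral {exp (- L * real n)..exp (L * real n)} ?f
       + integral {exp (L * real n)..exp (L * (real n + 1))} ?f) / of_real L"
      unfolding Suc.IH by (simp add: i_def add_divide_distrib)
    also have "integral {exp (L * (- real n - 1))..exp (- L * real n)} ?f
       + integral {exp (- L * real n)..exp (L * real n)} ?f = integral {exp (L * (- real n - 1))..exp (L * real n)} ?f"
      using L by (intro Henstock_Kurzweil_Integration.integral_combine intf) (auto simp: algebra_simps)
    also have "integral {exp (L * (- real n - 1))..exp (L * real n)} ?f
       + integral {exp (L * real n)..exp (L * (real n + 1))} ?f = integral {exp (L * (- real n - 1))..exp (L * (real n + 1))} ?f"
      using L by (intro Henstock_Kurzweil_Integration.integral_combine intf) (auto simp: algebra_simps)
    also have "L * (- real n - 1) = - L * real (Suc n)"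
      by (simp add: algebra_simps)
    also have "L * (real n + 1) = L * real (Suc n)"
      by simp
    finally show ?case .
  qed simp
  moreover have "(\<lambda>n. integral {exp (- L * real n)..exp (L * real n)} ?f / of_real L) \<longlonglongrightarrow> Gamma z / of_real L"
    using L by (intro tendsto_divide Gamma_truncated_limit L z tendsto_const) auto
  ultimately have "J = Gamma z / of_real L"
    using LIMSEQ_unique by simp
  with J show ?thesis
    by simp
qed

text \<open>Twisting by a mode only changes the exponent, so each Fourier coefficient of a theta sum
  is the mean of another theta sum, with the exponent moved along the same vertical line.\<close>

lemma theta_kernel_fmode:
  assumes "L \<noteq> 0"
  shows "theta_kernel z L u * fmode (- k) u = theta_kernel (z - 2 * of_real pi * \<i> * of_int k / of_real L) L u"
  using assms by (simp add: theta_kernel_def fmode_def cis_conv_exp exp_add[symmetric] algebra_simps)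

lemma theta_sum_fmode:
  assumes L: "L > 0" and z: "Re z > 0"
  shows "theta_sum z L t * fmode (- k) t = theta_sum (z - 2 * of_real pi * \<i> * of_int k / of_real L) L t"
proof -
  have "theta_kernel (z - 2 * of_real pi * \<i> * of_int k / of_real L) L (t + of_int j) =
      theta_kernel z L (t + of_int j) * fmode (- k) t" for j
    using theta_kernel_fmode[of L z "t + of_int j" k] L by (simp add: fmode_add_right)
  then show ?thesis
    unfolding theta_sum_def by (simp add: infsum_cmult_left')
qed

section \<open>Decay of Gamma on vertical lines\<close>

lemma norm_Gamma_le:
  assumes z: "Re z > 0"
  shows "norm (Gamma z) \<le> Gamma (Re z)"
proof -
  note C = Gamma_integral_complex[OF z] and R = Gamma_integral_real[OF z]
  have "norm (integral {0..} (\<lambda>t. complex_of_real t powr (z - 1) / of_real (exp t)))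
      \<le> integral {0..} (\<lambda>t. t powr (Re z - 1) / exp t)"
    using C R
    by (intro integral_norm_bound_integral) (auto simp: has_integral_iff norm_divide norm_powr_real_powr)
  then show ?thesis
    using C R by (simp add: integral_unique)
qed

text \<open>Since Re z > 0, each factor z + k is at least as far from 0 as z.\<close>

lemma norm_pochhammer_ge:
  assumes z: "Re z > 0"
  shows "norm z ^ n \<le> norm (pochhammer z n)"
proof (induction n)
  case (Suc n)
  have "(Re z)\<^sup>2 \<le> (Re z + real n)\<^sup>2"
    using z by (intro power_mono) auto
  then have "norm z \<le> norm (z + of_nat n)"
    by (simp add: cmod_def)
  then show ?case
    using Suc by (simp add: pochhammer_Suc norm_mult mult.commute[of "norm z"] mult_mono)
qed simp

text \<open>The functional equation trades n factors for a shift of the argument by n, so polynomial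
  decay of every order follows from boundedness of Gamma on vertical lines in the right half-plane,
  without Stirling's formula.\<close>

lemma Gamma_decay:
  assumes z: "Re z > 0"
  shows "norm z ^ n * norm (Gamma z) \<le> Gamma (Re z + real n)"
proof -
  have "z \<notin> \<int>\<^sub>\<le>\<^sub>0"
    using z by (auto elim!: nonpos_Ints_cases)
  then have "pochhammer z n * Gamma z = Gamma (z + of_nat n)"
    by (simp add: pochhammer_Gamma Gamma_eq_zero_iff)
  then have "norm z ^ n * norm (Gamma z) \<le> norm (Gamma (z + of_nat n))"
    using mult_right_mono[OF norm_pochhammer_ge[OF z, of n] norm_ge_zero[of "Gamma z"]]
    by (simp add: norm_mult[symmetric])
  also have "\<dots> \<le> Gamma (Re z + real n)"
    using norm_Gamma_le[of "z + of_nat n"] z by simp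
  finally show ?thesis .
qed

text \<open>The case n = 0 gives absolute convergence of the Fourier series; the higher powers of
  |k| allow termwise differentiation to every order.\<close>

lemma Gamma_vertical_summable:
  assumes L: "L > 0" and z: "Re z > 0"
  shows "(\<lambda>k::int. \<bar>of_int k\<bar> ^ n * norm (Gamma (z - 2 * of_real pi * \<i> * of_int k / of_real L))) summable_on UNIV"
proof -
  define w where "w = (\<lambda>k::int. z - 2 * of_real pi * \<i> * of_int k / of_real L)"
  \<comment> \<open>K converts |k| into |w k|: the distance from z to w k is 2 pi |k| / L, and |z|
    is at most (|z| / Re z) |w k| because w k has the same real part as z.\<close>
  define K where "K = L * (1 + norm z / Re z)"
  have rw: "Re (w k) = Re z" for k
    by (simp add: w_def)
  have K: "\<bar>of_int k\<bar> \<le> K * norm (w k)" for k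
  proof -
    have "norm z \<le> norm z / Re z * norm (w k)"
      using mult_left_mono[OF complex_Re_le_cmod[of "w k"], of "norm z"] z by (simp add: rw field_simps)
    moreover have "norm (2 * of_real pi * \<i> * of_int k / of_real L) \<le> norm (w k) + norm z"
      using norm_triangle_ineq4[of z "w k"] by (simp add: w_def)
    then have "2 * pi * \<bar>of_int k\<bar> / L \<le> norm (w k) + norm z"
      using L by (simp add: norm_mult norm_divide)
    moreover have "\<bar>of_int k\<bar> / L \<le> 2 * pi * \<bar>of_int k\<bar> / L"
      using pi_ge_two L by (intro divide_right_mono mult_right_mono[of 1 "2 * pi" "\<bar>of_int k\<bar>", simplified]) auto
    ultimately have "\<bar>of_int k\<bar> / L \<le> (1 + norm z / Re z) * norm (w k)"
      by (simp add: algebra_simps)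
    then show ?thesis
      using L by (simp add: K_def field_simps)
  qed
  have bound: "\<bar>of_int k\<bar> ^ m * norm (Gamma (w k)) \<le> K ^ m * Gamma (Re z + real m)" for k m
  proof -
    have K0: "K \<ge> 0"
      using L z by (simp add: K_def)
    have "\<bar>of_int k\<bar> ^ m * norm (Gamma (w k)) \<le> (K * norm (w k)) ^ m * norm (Gamma (w k))"
      by (intro mult_right_mono power_mono K) auto
    also have "\<dots> \<le> K ^ m * Gamma (Re z + real m)"
      using Gamma_decay[of "w k" m] z K0 by (simp add: rw power_mult_distrib mult.assoc mult_left_mono)
    finally show ?thesis .
  qed
  \<comment> \<open>The bounds of orders n and n + 2 add up to a bound after multiplication by 1 +
    k^2, which leaves a summable majorant that is also defined at k = 0.\<close>
  define D where "D = K ^ n * Gamma (Re z + real n) + K ^ (n + 2) * Gamma (Re z + real (n + 2))"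
  have "(\<lambda>m. D * (1 / (1 + (real m)\<^sup>2))) summable_on UNIV"
  proof (intro summable_on_cmult_right summable_nonneg_imp_summable_on)
    show "summable (\<lambda>m. 1 / (1 + (real m)\<^sup>2))"
    proof (rule summable_comparison_test')
      show "summable (\<lambda>m. inverse ((real m)\<^sup>2))"
        by (rule inverse_power_summable) simp
      show "norm (1 / (1 + (real m)\<^sup>2)) \<le> inverse ((real m)\<^sup>2)" if "m \<ge> 1" for m
        using that by (simp add: inverse_eq_divide frac_le add_increasing)
    qed
  qed auto
  then have s: "(\<lambda>k::int. D * (1 / (1 + (of_int k)\<^sup>2))) summable_on UNIV"
    by (intro summable_on_intI) auto
  have "(\<lambda>k. \<bar>of_int k\<bar> ^ n * norm (Gamma (w k))) summable_on UNIV"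
  proof (rule summable_on_comparison_test[OF s])
    fix k :: int
    have "(1 + (of_int k)\<^sup>2) * (\<bar>of_int k\<bar> ^ n * norm (Gamma (w k)))
        = \<bar>of_int k\<bar> ^ n * norm (Gamma (w k)) + \<bar>of_int k\<bar> ^ (n + 2) * norm (Gamma (w k))"
      by (simp add: power_add power2_eq_square algebra_simps)
    also have "\<dots> \<le> D"
      unfolding D_def by (intro add_mono bound)
    finally show "\<bar>of_int k\<bar> ^ n * norm (Gamma (w k)) \<le> D * (1 / (1 + (of_int k)\<^sup>2))"
      by (simp add: pos_le_divide_eq add_pos_nonneg mult.commute)
  qed auto
  then show ?thesis
    by (simp only: w_def)
qed

text \<open>Poisson summation for the kernel: its Fourier transform at frequency k is Gamma at the
  shifted exponent, divided by L.\<close>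

theorem theta_sum_fourier_series:
  assumes L: "L > 0" and z: "Re z > 0"
  shows "((\<lambda>k. Gamma (z - 2 * of_real pi * \<i> * of_int k / of_real L) / of_real L * fmode k t) has_sum theta_sum z L t) UNIV"
proof -
  obtain M where M: "\<And>x y. \<bar>x - y\<bar> \<le> 1 \<Longrightarrow> norm (theta_sum z L x - theta_sum z L y) \<le> M * \<bar>x - y\<bar>"
    using theta_sum_lipschitz[OF z L] by blast
  show ?thesis
  proof (rule fourier_inversion[OF theta_sum_periodic M])
    show "((\<lambda>t. theta_sum z L t * fmode (- k) t) has_integral
        Gamma (z - 2 * of_real pi * \<i> * of_int k / of_real L) / of_real L) {0..1}" for k
      unfolding theta_sum_fmode[OF L z] using z by (intro has_integral_theta_sum L) simp
    show "(\<lambda>k. norm (Gamma (z - 2 * of_real pi * \<i> * of_int k / of_real L) / of_real L)) summable_on UNIV"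
      using summable_on_cmult_right[OF Gamma_vertical_summable[OF L z, of 0], of "1 / L"] L
      by (simp add: norm_divide)
  qed
qed

section \<open>Restricted digits\<close>

lemma digits_in_0 [simp]: "b > 0 \<Longrightarrow> 0 \<in> digits_in b D"
  by (simp add: digits_in_def)

text \<open>Splitting off the last digit shifts all other digit positions by one. Membership of 0 in
  D covers n = d = 0: the integer 0 passes no digit test, yet its last digit has to lie in
  D.\<close>

lemma digits_in_step:
  assumes b: "b > 0" and D: "0 \<in> D" and d: "d < b"
  shows "b * n + d \<in> digits_in b D \<longleftrightarrow> n \<in> digits_in b D \<and> d \<in> D"
proof (intro iffI conjI)
  have div: "(b * n + d) div b ^ Suc i = n div b ^ i" for i
    using d by (simp add: div_mult2_eq)
  assume *: "b * n + d \<in> digits_in b D"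
  show "d \<in> D"
  proof (cases "b * n + d = 0")
    case False
    then have "1 \<le> b * n + d"
      by linarith
    then have "(b * n + d) div b ^ 0 mod b \<in> D"
      using * unfolding digits_in_def by (metis (mono_tags, lifting) mem_Collect_eq power_0)
    then show ?thesis
      using d by simp
  qed (use D in simp)
  show "n \<in> digits_in b D"
    unfolding digits_in_def
  proof (intro CollectI allI impI)
    fix i assume "b ^ i \<le> n"
    then have "b ^ Suc i \<le> b * n + d"
      by (simp add: trans_le_add1)
    then have "(b * n + d) div b ^ Suc i mod b \<in> D"
      using * unfolding digits_in_def by blast
    then show "n div b ^ i mod b \<in> D"
      unfolding div .
  qed
next
  have div: "(b * n + d) div b ^ Suc i = n div b ^ i" for i
    using d by (simp add: div_mult2_eq)
  assume *: "n \<in> digits_in b D \<and> d \<in> D"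
  show "b * n + d \<in> digits_in b D"
    unfolding digits_in_def
  proof (intro CollectI allI impI)
    fix i assume i: "b ^ i \<le> b * n + d"
    show "(b * n + d) div b ^ i mod b \<in> D"
    proof (cases i)
      case 0
      then show ?thesis using d * by simp
    next
      case (Suc j)
      have "b ^ Suc j div b \<le> (b * n + d) div b"
        using i Suc by (intro div_le_mono) simp
      then have "b ^ j \<le> n"
        using b d by simp
      then show ?thesis
        using * unfolding Suc div digits_in_def by blast
    qed
  qed
qed

text \<open>The range n < b^l stands for words of length exactly l: shorter integers are padded by
  leading zeros, which are admissible because 0 lies in D.\<close>

lemma bij_betw_digits_in_below_Suc:
  assumes b: "b > 0" and D: "0 \<in> D" "D \<subseteq> {..<b}"
  shows "bij_betw (\<lambda>(n, d). b * n + d) ({n \<in> digits_in b D. n < b ^ l} \<times> D) {n \<in> digits_in b D. n < b ^ Suc l}"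
proof (rule bij_betwI[where g = "\<lambda>n. (n div b, n mod b)"])
  show "(\<lambda>(n, d). b * n + d) \<in> {n \<in> digits_in b D. n < b ^ l} \<times> D \<rightarrow> {n \<in> digits_in b D. n < b ^ Suc l}"
  proof (rule Pi_I)
    fix p assume "p \<in> {n \<in> digits_in b D. n < b ^ l} \<times> D"
    then obtain n d where p: "p = (n, d)" and n: "n \<in> digits_in b D" "n < b ^ l" and d: "d \<in> D"
      by auto
    have "b * n + d < b * n + b"
      using d D by auto
    also have "\<dots> = b * (n + 1)"
      by simp
    also have "\<dots> \<le> b * b ^ l"
      using n by (intro mult_le_mono) auto
    finally show "(\<lambda>(n, d). b * n + d) p \<in> {n \<in> digits_in b D. n < b ^ Suc l}"
      using digits_in_step[OF b D(1), of d n] n d D by (auto simp: p)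
  qed
  show "(\<lambda>n. (n div b, n mod b)) \<in> {n \<in> digits_in b D. n < b ^ Suc l} \<rightarrow> {n \<in> digits_in b D. n < b ^ l} \<times> D"
  proof (rule Pi_I)
    fix n assume "n \<in> {n \<in> digits_in b D. n < b ^ Suc l}"
    then have n: "n \<in> digits_in b D" "n < b ^ Suc l"
      by auto
    have "n div b < b ^ l"
      using n(2) b by (simp add: div_less_iff_less_mult mult.commute)
    moreover have "b * (n div b) + n mod b \<in> digits_in b D"
      using n(1) by simp
    then have "n div b \<in> digits_in b D \<and> n mod b \<in> D"
      using digits_in_step[OF b D(1), of "n mod b" "n div b"] b by simp
    ultimately show "(n div b, n mod b) \<in> {n \<in> digits_in b D. n < b ^ l} \<times> D"
      by simp
  qed
qed (use D in auto)

lemma wval_snoc: "wval b (w @ [a]) = wval b w + real a / real b ^ Suc (length w)"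
  unfolding wval_def by (simp add: nth_append)

lemma wval_nonneg: "wval b w \<ge> 0"
  unfolding wval_def by (intro sum_nonneg) auto

text \<open>Induction appends a last letter a to the word and the digit f - a to the integer. It
  closes because \<open>\<kappa> * f + 1 = b\<close>, whence b (\<kappa> n + 1) - \<kappa> a =
  \<kappa> (b n + f - a) + 1. The test function is arbitrary in the induction since the new letter
  shifts its argument.\<close>

lemma sum_words_eq_sum_digits:
  fixes g :: "real \<Rightarrow> 'a :: comm_monoid_add"
  assumes A: "A \<subseteq> {0..<b}" "A \<noteq> {}" and f: "f = Max A" "f > 0"
    and \<kappa>: "\<kappa> = (real b - 1) / real f"
  shows "(\<Sum>w\<in>{w. length w = l \<and> set w \<subseteq> A}. g (\<kappa> * wval b w))
    = (\<Sum>n\<in>{n \<in> digits_in b ((\<lambda>a. f - a) ` A). n < b ^ l}. g (1 - (\<kappa> * real n + 1) / real b ^ l))"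
proof -
  let ?S = "digits_in b ((\<lambda>a. f - a) ` A)"
  have fin: "finite A"
    by (rule finite_subset[OF A(1)]) simp
  have le: "a \<le> f" if "a \<in> A" for a
    using fin f that by auto
  have fA: "f \<in> A"
    using fin A f by auto
  then have b: "b > 0"
    using A by auto
  show ?thesis
  proof (induction l arbitrary: g)
    case 0
    have "{n \<in> ?S. n < b ^ 0} = {0}"
      using b by auto
    moreover have "{w. length w = 0 \<and> set w \<subseteq> A} = {[]}"
      by auto
    ultimately show ?case
      by (simp add: wval_def)
  next
    case (Suc l)
    let ?D = "(\<lambda>a. f - a) ` A"
    have D: "0 \<in> ?D" "?D \<subseteq> {..<b}"
      using fA A by (auto intro!: image_eqI[of _ _ f])
    have bij: "bij_betw (\<lambda>(w, a). w @ [a]) ({w. length w = l \<and> set w \<subseteq> A} \<times> A) {w. length w = Suc l \<and> set w \<subseteq> A}"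
      by (rule bij_betwI[where g = "\<lambda>w. (butlast w, last w)"])
         (auto dest: in_set_butlastD simp: length_Suc_conv_rev)
    have inj: "inj_on (\<lambda>a. f - a) A"
      using le by (auto simp: inj_on_def) (metis diff_diff_cancel)
    have \<kappa>f: "\<kappa> * real f + 1 = real b"
      using f \<kappa> by simp
    have "(\<Sum>w\<in>{w. length w = Suc l \<and> set w \<subseteq> A}. g (\<kappa> * wval b w))
        = (\<Sum>(w, a)\<in>{w. length w = l \<and> set w \<subseteq> A} \<times> A. g (\<kappa> * wval b (w @ [a])))"
      by (subst sum.reindex_bij_betw[OF bij, symmetric]) (simp add: case_prod_unfold)
    also have "\<dots> = (\<Sum>w\<in>{w. length w = l \<and> set w \<subseteq> A}. \<Sum>a\<in>A. g (\<kappa> * wval b w + \<kappa> * real a / real b ^ Suc l))"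
      unfolding sum.cartesian_product[symmetric]
      by (intro sum.cong refl) (simp add: wval_snoc algebra_simps)
    also have "\<dots> = (\<Sum>n\<in>{n \<in> ?S. n < b ^ l}. \<Sum>a\<in>A. g (1 - (\<kappa> * real n + 1) / real b ^ l + \<kappa> * real a / real b ^ Suc l))"
      by (rule Suc.IH)
    also have "\<dots> = (\<Sum>n\<in>{n \<in> ?S. n < b ^ l}. \<Sum>d\<in>?D. g (1 - (\<kappa> * real (b * n + d) + 1) / real b ^ Suc l))"
    proof (rule sum.cong[OF refl])
      fix n
      have "1 - (\<kappa> * real n + 1) / real b ^ l + \<kappa> * real a / real b ^ Suc l
          = 1 - (\<kappa> * real (b * n + (f - a)) + 1) / real b ^ Suc l" if "a \<in> A" for a
      proof -
        have "1 - (\<kappa> * real n + 1) / real b ^ l + \<kappa> * real a / real b ^ Suc l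
            = 1 - (real b * (\<kappa> * real n) + real b - \<kappa> * real a) / real b ^ Suc l"
          using b by (simp add: field_simps)
        also have "real b * (\<kappa> * real n) + real b - \<kappa> * real a = \<kappa> * real (b * n + (f - a)) + 1"
          using le[OF that] \<kappa>f by (simp add: of_nat_diff algebra_simps)
        finally show ?thesis .
      qed
      note eq = this
      show "(\<Sum>a\<in>A. g (1 - (\<kappa> * real n + 1) / real b ^ l + \<kappa> * real a / real b ^ Suc l))
          = (\<Sum>d\<in>?D. g (1 - (\<kappa> * real (b * n + d) + 1) / real b ^ Suc l))"
        unfolding sum.reindex[OF inj] o_def by (intro sum.cong refl arg_cong[of _ _ g] eq)
    qed
    also have "\<dots> = (\<Sum>(n, d)\<in>{n \<in> ?S. n < b ^ l} \<times> ?D. g (1 - (\<kappa> * real (b * n + d) + 1) / real b ^ Suc l))"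
      by (rule sum.cartesian_product)
    also have "\<dots> = (\<Sum>n\<in>{n \<in> ?S. n < b ^ Suc l}. g (1 - (\<kappa> * real n + 1) / real b ^ Suc l))"
      by (subst sum.reindex_bij_betw[OF bij_betw_digits_in_below_Suc[OF b D], symmetric]) (simp add: case_prod_unfold)
    finally show ?case .
  qed
qed

text \<open>The constant test function 1 turns the identity between words and integers into a
  count.\<close>

lemma card_digits_in_below:
  assumes A: "A \<subseteq> {0..<b}" "A \<noteq> {}" and f: "f = Max A" "f > 0"
  shows "card {n \<in> digits_in b ((\<lambda>a. f - a) ` A). n < b ^ l} = card A ^ l"
proof -
  have "finite A"
    by (rule finite_subset[OF A(1)]) simp
  then have "card {w. length w = l \<and> set w \<subseteq> A} = card A ^ l"
    using card_lists_length_eq[of A l] by (simp add: conj_commute)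
  then show ?thesis
    using sum_words_eq_sum_digits[OF A f refl, of "\<lambda>_. 1 :: nat" l] by simp
qed

text \<open>Grouping by digit length: the block b^l \<le> n < b^(l+1) has at most N^(l+1) members,
  each contributing at most b^(-\<sigma> l). The blocks are dominated by a geometric series of ratio
  q = N b^(-\<sigma>), and the lower bound on \<sigma> is what makes q < 1.\<close>

lemma digits_in_dirichlet_summable:
  assumes b: "b \<ge> 2" and A: "A \<subseteq> {0..<b}" "A \<noteq> {}" and f: "f = Max A" "f > 0"
    and \<sigma>: "\<sigma> > log (real b) (real (card A))" and \<kappa>: "\<kappa> \<ge> 1"
  shows "(\<lambda>n. (\<kappa> * real n + 1) powr - \<sigma>) summable_on digits_in b ((\<lambda>a. f - a) ` A)"
proof -
  let ?S = "digits_in b ((\<lambda>a. f - a) ` A)"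
  define N where "N = card A"
  have "finite A"
    by (rule finite_subset[OF A(1)]) simp
  then have N: "N \<ge> 1"
    using A(2) by (simp add: N_def Suc_le_eq card_gt_0_iff)
  have \<sigma>0: "\<sigma> > 0"
  proof -
    have "log (real b) (real N) \<ge> 0"
      using b N by simp
    then show ?thesis
      using \<sigma> by (simp add: N_def)
  qed
  define q where "q = real N * real b powr - \<sigma>"
  have q: "0 \<le> q" "q < 1"
  proof -
    have "real N = real b powr log (real b) (real N)"
      using N b by simp
    also have "\<dots> < real b powr \<sigma>"
      using \<sigma> b by (intro powr_less_mono) (auto simp: N_def)
    finally show "q < 1"
      using b by (simp add: q_def powr_minus field_simps)
  qed (simp add: q_def)
  \<comment> \<open>The summand 1 is the term n = 0, and the block between b^l and b^(l+1) adds at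
    most N q^l.\<close>
  have bound: "(\<Sum>n\<in>{n \<in> ?S. n < b ^ l}. (\<kappa> * real n + 1) powr - \<sigma>) \<le> 1 + real N * (\<Sum>i<l. q ^ i)" for l
  proof (induction l)
    case 0
    have "{n \<in> ?S. n < b ^ 0} = {0}"
      using b by auto
    then show ?case by simp
  next
    case (Suc l)
    have le: "b ^ l \<le> b ^ Suc l"
      using b by (intro power_increasing) auto
    have split: "{n \<in> ?S. n < b ^ Suc l} = {n \<in> ?S. n < b ^ l} \<union> {n \<in> ?S. b ^ l \<le> n \<and> n < b ^ Suc l}"
      by (auto simp del: power_Suc dest: order_less_le_trans[OF _ le])
    have "(\<Sum>n\<in>{n \<in> ?S. n < b ^ Suc l}. (\<kappa> * real n + 1) powr - \<sigma>)
        = (\<Sum>n\<in>{n \<in> ?S. n < b ^ l}. (\<kappa> * real n + 1) powr - \<sigma>)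
        + (\<Sum>n\<in>{n \<in> ?S. b ^ l \<le> n \<and> n < b ^ Suc l}. (\<kappa> * real n + 1) powr - \<sigma>)"
      unfolding split by (rule sum.union_disjoint) auto
    moreover have "(\<Sum>n\<in>{n \<in> ?S. b ^ l \<le> n \<and> n < b ^ Suc l}. (\<kappa> * real n + 1) powr - \<sigma>)
        \<le> (\<Sum>n\<in>{n \<in> ?S. b ^ l \<le> n \<and> n < b ^ Suc l}. (real b powr - \<sigma>) ^ l)"
    proof (rule sum_mono)
      fix n assume "n \<in> {n \<in> ?S. b ^ l \<le> n \<and> n < b ^ Suc l}"
      then have "real b ^ l \<le> real n"
        by (simp flip: of_nat_power)
      also have "\<dots> \<le> \<kappa> * real n + 1"
        using mult_right_mono[OF \<kappa>, of "real n"] by simp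
      finally have "(\<kappa> * real n + 1) powr - \<sigma> \<le> (real b ^ l) powr - \<sigma>"
        using \<sigma>0 b by (intro powr_mono2') auto
      also have "\<dots> = (real b powr real l) powr - \<sigma>"
        using b by (simp add: powr_realpow)
      also have "\<dots> = (real b powr - \<sigma>) powr real l"
        by (simp only: powr_powr mult.commute)
      also have "\<dots> = (real b powr - \<sigma>) ^ l"
        using b by (intro powr_realpow) simp
      finally show "(\<kappa> * real n + 1) powr - \<sigma> \<le> (real b powr - \<sigma>) ^ l" .
    qed
    moreover have "(\<Sum>n\<in>{n \<in> ?S. b ^ l \<le> n \<and> n < b ^ Suc l}. (real b powr - \<sigma>) ^ l) \<le> real (N ^ Suc l) * (real b powr - \<sigma>) ^ l"
    proof -
      have "card {n \<in> ?S. b ^ l \<le> n \<and> n < b ^ Suc l} \<le> card {n \<in> ?S. n < b ^ Suc l}"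
        by (intro card_mono) auto
      also have "\<dots> = N ^ Suc l"
        unfolding N_def by (rule card_digits_in_below[OF A f])
      finally show ?thesis
        unfolding sum_constant by (intro mult_right_mono) (auto simp del: power_Suc)
    qed
    moreover have "real (N ^ Suc l) * (real b powr - \<sigma>) ^ l = real N * q ^ l"
      by (simp add: q_def power_mult_distrib)
    moreover have "1 + real N * (\<Sum>i<Suc l. q ^ i) = 1 + real N * (\<Sum>i<l. q ^ i) + real N * q ^ l"
      by (simp add: algebra_simps)
    ultimately show ?case
      using Suc.IH by linarith
  qed
  have geo: "(\<Sum>i<l. q ^ i) \<le> 1 / (1 - q)" for l
    using q sum_le_suminf[of "\<lambda>i. q ^ i" "{..<l}"] by (simp add: suminf_geometric summable_geometric)
  show ?thesis
  proof (rule nonneg_bdd_above_summable_on)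
    show "bdd_above (sum (\<lambda>n. (\<kappa> * real n + 1) powr - \<sigma>) ` {F. F \<subseteq> ?S \<and> finite F})"
    proof (rule bdd_aboveI2)
      fix F assume "F \<in> {F. F \<subseteq> ?S \<and> finite F}"
      then have F: "F \<subseteq> ?S" "finite F"
        by auto
      have "F \<subseteq> {n \<in> ?S. n < b ^ Max (insert 0 F)}"
      proof
        fix n assume n: "n \<in> F"
        have "n < b ^ n"
          using b by (intro power_gt_expt) auto
        also have "\<dots> \<le> b ^ Max (insert 0 F)"
          using b n F by (intro power_increasing) auto
        finally show "n \<in> {n \<in> ?S. n < b ^ Max (insert 0 F)}"
          using n F by auto
      qed
      then have "(\<Sum>n\<in>F. (\<kappa> * real n + 1) powr - \<sigma>) \<le> (\<Sum>n\<in>{n \<in> ?S. n < b ^ Max (insert 0 F)}. (\<kappa> * real n + 1) powr - \<sigma>)"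
        by (intro sum_mono2) auto
      also have "\<dots> \<le> 1 + real N * (\<Sum>i<Max (insert 0 F). q ^ i)"
        by (rule bound)
      also have "\<dots> \<le> 1 + real N * (1 / (1 - q))"
        by (rule add_left_mono[OF mult_left_mono[OF geo]]) simp
      finally show "(\<Sum>n\<in>F. (\<kappa> * real n + 1) powr - \<sigma>) \<le> 1 + real N * (1 / (1 - q))" .
    qed
  qed (rule powr_ge_zero)
qed

section \<open>Differentiation of Fourier series\<close>

text \<open>Enumerates the integers so that termwise differentiation can be carried out for a series
  indexed by the naturals.\<close>

lemma infsum_int_eq_suminf:
  fixes u :: "int \<Rightarrow> complex"
  assumes "(\<lambda>k. norm (u k)) summable_on UNIV"
  shows "(\<lambda>n. u (int_decode n)) sums (\<Sum>\<^sub>\<infinity>k. u k)"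
proof (rule has_sum_imp_sums)
  have "(u has_sum (\<Sum>\<^sub>\<infinity>k. u k)) UNIV"
    by (rule has_sum_infsum[OF abs_summable_summable[OF assms]])
  then show "((\<lambda>n. u (int_decode n)) has_sum (\<Sum>\<^sub>\<infinity>k. u k)) UNIV"
    using has_sum_reindex_bij_betw[OF bij_int_decode, of u] by simp
qed

text \<open>The M-test applies to the differentiated series uniformly on the whole line because
  modes have modulus 1.\<close>

lemma has_vector_derivative_fmode_series:
  assumes a: "(\<lambda>k. norm (a k)) summable_on UNIV"
    and a': "(\<lambda>k. \<bar>of_int k\<bar> * norm (a k)) summable_on UNIV"
  shows "((\<lambda>t. \<Sum>\<^sub>\<infinity>k. a k * fmode k t) has_vector_derivative
           (\<Sum>\<^sub>\<infinity>k. 2 * pi * \<i> * of_int k * a k * fmode k t)) (at t)"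
proof -
  define d where "d = (\<lambda>k t. 2 * pi * \<i> * of_int k * a k * fmode k t)"
  define M where "M = (\<lambda>k. 2 * pi * (\<bar>of_int k\<bar> * norm (a k)))"
  have norm_d: "norm (d k t) = M k" for k t
    by (simp add: d_def M_def norm_mult)
  have M: "M summable_on UNIV"
    unfolding M_def by (intro summable_on_cmult_right a')
  have "(\<lambda>n. M (int_decode n)) summable_on UNIV"
    using summable_on_reindex_bij_betw[OF bij_int_decode, of M] M by simp
  then have M': "summable (\<lambda>n. M (int_decode n))"
    by (rule summable_on_imp_summable)
  have ulim: "uniform_limit UNIV (\<lambda>n t. \<Sum>i<n. d (int_decode i) t) (\<lambda>t. \<Sum>i. d (int_decode i) t) sequentially"
    by (rule Weierstrass_m_test[OF _ M']) (simp add: norm_d)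
  have dsum: "(\<Sum>i. d (int_decode i) t) = (\<Sum>\<^sub>\<infinity>k. d k t)" for t
    by (rule sums_unique[symmetric, OF infsum_int_eq_suminf]) (simp add: norm_d M)
  have "\<exists>g. \<forall>x\<in>UNIV. (\<lambda>n. a (int_decode n) * fmode (int_decode n) x) sums g x \<and>
      (g has_derivative (\<lambda>h. h *\<^sub>R (\<Sum>\<^sub>\<infinity>k. d k x))) (at x within UNIV)"
  proof (rule has_derivative_series)
    fix n x
    show "((\<lambda>x. a (int_decode n) * fmode (int_decode n) x) has_derivative (\<lambda>h. h *\<^sub>R d (int_decode n) x)) (at x within UNIV)"
      using has_vector_derivative_mult_right[OF has_vector_derivative_fmode, of "a (int_decode n)" "int_decode n" x UNIV]
      by (simp add: has_vector_derivative_def d_def mult_ac)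
  next
    fix e :: real assume "e > 0"
    with ulim have "\<forall>\<^sub>F n in sequentially. \<forall>x\<in>UNIV. dist (\<Sum>i<n. d (int_decode i) x) (\<Sum>i. d (int_decode i) x) < e"
      by (auto simp: uniform_limit_iff)
    then show "\<forall>\<^sub>F n in sequentially. \<forall>x\<in>UNIV. \<forall>h. norm ((\<Sum>i<n. h *\<^sub>R d (int_decode i) x) - h *\<^sub>R (\<Sum>\<^sub>\<infinity>k. d k x)) \<le> e * norm h"
    proof eventually_elim
      case (elim n)
      show ?case
      proof (intro ballI allI)
        fix x h :: real
        have "norm ((\<Sum>i<n. h *\<^sub>R d (int_decode i) x) - h *\<^sub>R (\<Sum>\<^sub>\<infinity>k. d k x))
            = \<bar>h\<bar> * norm ((\<Sum>i<n. d (int_decode i) x) - (\<Sum>\<^sub>\<infinity>k. d k x))"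
          by (simp add: scaleR_sum_right[symmetric] scaleR_diff_right[symmetric])
        also have "\<dots> \<le> \<bar>h\<bar> * e"
          using elim by (intro mult_left_mono) (auto simp: dist_norm dsum intro: less_imp_le)
        finally show "norm ((\<Sum>i<n. h *\<^sub>R d (int_decode i) x) - h *\<^sub>R (\<Sum>\<^sub>\<infinity>k. d k x)) \<le> e * norm h"
          by (simp add: mult.commute)
      qed
    qed
  next
    show "(\<lambda>n. a (int_decode n) * fmode (int_decode n) 0) sums (\<Sum>\<^sub>\<infinity>k. a k * fmode k 0)"
      by (rule infsum_int_eq_suminf) (simp add: norm_mult a)
  qed auto
  then obtain g where g: "\<And>x. (\<lambda>n. a (int_decode n) * fmode (int_decode n) x) sums g x"
      "\<And>x. (g has_derivative (\<lambda>h. h *\<^sub>R (\<Sum>\<^sub>\<infinity>k. d k x))) (at x)"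
    by auto
  have "g x = (\<Sum>\<^sub>\<infinity>k. a k * fmode k x)" for x
    by (rule sums_unique2[OF g(1) infsum_int_eq_suminf]) (simp add: norm_mult a)
  then have "g = (\<lambda>t. \<Sum>\<^sub>\<infinity>k. a k * fmode k t)"
    by auto
  then show ?thesis
    using g(2)[of t] by (simp add: has_vector_derivative_def d_def)
qed

section \<open>The scaled moments\<close>

text \<open>Tonelli's criterion in the form in which all double sums below arise: the weight w is
  \<open>norm (W n)\<close>, and C is a bound for the inner sum that does not depend on n.\<close>

lemma dominated_double_sum:
  fixes F :: "'a \<Rightarrow> 'b \<Rightarrow> complex"
  assumes F: "\<And>x. x \<in> A \<Longrightarrow> (\<lambda>y. norm (F x y)) summable_on B"
    and le: "\<And>x. x \<in> A \<Longrightarrow> (\<Sum>\<^sub>\<infinity>y\<in>B. norm (F x y)) \<le> C * w x"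
    and w: "w summable_on A"
  shows "(\<lambda>(x, y). norm (F x y)) summable_on A \<times> B"
    and "(\<Sum>\<^sub>\<infinity>(x, y)\<in>A \<times> B. norm (F x y)) \<le> C * infsum w A"
    and "(\<lambda>(x, y). F x y) summable_on A \<times> B"
proof -
  have Cw: "(\<lambda>x. C * w x) summable_on A"
    by (intro summable_on_cmult_right w)
  have inner: "(\<lambda>x. \<Sum>\<^sub>\<infinity>y\<in>B. norm (F x y)) summable_on A"
    by (rule summable_on_comparison_test[OF Cw le]) (auto intro: infsum_nonneg)
  have "(\<lambda>p. norm ((\<lambda>(x, y). F x y) p)) summable_on A \<times> B"
    unfolding Infinite_Sum.abs_summable_on_Sigma_iff using F inner by (simp add: infsum_nonneg)
  then show s: "(\<lambda>(x, y). norm (F x y)) summable_on A \<times> B"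
    by (simp add: case_prod_unfold)
  have "(\<Sum>\<^sub>\<infinity>(x, y)\<in>A \<times> B. norm (F x y)) = (\<Sum>\<^sub>\<infinity>x\<in>A. \<Sum>\<^sub>\<infinity>y\<in>B. norm (F x y))"
    by (rule infsum_Sigma'_banach[OF s, symmetric])
  also have "\<dots> \<le> (\<Sum>\<^sub>\<infinity>x\<in>A. C * w x)"
    by (rule infsum_mono[OF inner Cw le])
  finally show "(\<Sum>\<^sub>\<infinity>(x, y)\<in>A \<times> B. norm (F x y)) \<le> C * infsum w A"
    by (simp add: infsum_cmult_right')
  show "(\<lambda>(x, y). F x y) summable_on A \<times> B"
    by (rule abs_summable_summable) (use s in \<open>simp add: case_prod_unfold\<close>)
qed

text \<open>Truncation at 0 removes the terms that do not belong to the moment: with y = (\<kappa> n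
  + 1) / b^l one has y \<ge> 1 whenever l \<le> 0 or n \<ge> b^l. This permits a sum over all n and
  all integers l.\<close>

definition pos_powr :: "real \<Rightarrow> real \<Rightarrow> real" where
  "pos_powr x m = (if 0 < x then x powr m else 0)"

lemma pos_powr_nonneg: "0 \<le> pos_powr x m"
  by (simp add: pos_powr_def)

lemma pos_powr_one_minus_le:
  assumes "m > 0"
  shows "pos_powr (1 - y) m \<le> exp (- (m * y))"
proof (cases "y < 1")
  case True
  have "(1 - y) powr m \<le> exp (- y) powr m"
    using True assms exp_ge_add_one_self[of "- y"] by (intro powr_mono2) auto
  then show ?thesis
    using True by (simp add: pos_powr_def exp_powr_real mult.commute)
qed (simp add: pos_powr_def)

text \<open>Convexity of exp: v = ln (1 + x) is the convex combination of 0 and m v with weight 1 /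
  m on the latter.\<close>

lemma bernoulli_powr:
  fixes m x :: real
  assumes "m \<ge> 1" "x > - 1"
  shows "1 + m * x \<le> (1 + x) powr m"
proof -
  define v where "v = ln (1 + x)"
  have "exp ((1 - 1 / m) *\<^sub>R 0 + (1 / m) *\<^sub>R (m * v)) \<le> (1 - 1 / m) * exp 0 + 1 / m * exp (m * v)"
    using assms by (intro convex_onD[OF exp_convex]) auto
  then have "m * exp v \<le> m * ((1 - 1 / m) + 1 / m * exp (m * v))"
    using assms by (intro mult_left_mono) auto
  also have "\<dots> = m - 1 + exp (m * v)"
    using assms by (simp add: field_simps)
  finally have "m * exp v \<le> m - 1 + exp (m * v)" .
  moreover have "exp v = 1 + x"
    using assms by (simp add: v_def)
  moreover have "exp (m * v) = (1 + x) powr m"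
    using assms by (simp add: v_def powr_def)
  ultimately show ?thesis
    by (simp add: algebra_simps)
qed

text \<open>The lower bound comes from exp (- y) (1 - y^2) \<le> 1 - y and Bernoulli's inequality.\<close>

lemma pos_powr_one_minus_ge:
  assumes "m \<ge> 1" "y > 0"
  shows "exp (- (m * y)) - pos_powr (1 - y) m \<le> m * y\<^sup>2 * exp (- (m * y))"
proof (cases "y < 1")
  case True
  have "(1 + y) * (1 - y) \<le> exp y * (1 - y)"
    using True by (intro mult_right_mono) (auto simp: add.commute)
  then have "exp (- y) * (1 - y\<^sup>2) \<le> 1 - y"
    by (simp add: exp_minus field_simps power2_eq_square)
  then have "(exp (- y) * (1 - y\<^sup>2)) powr m \<le> (1 - y) powr m"
    using assms True by (intro powr_mono2) (auto simp: power_le_one)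
  also have "(exp (- y) * (1 - y\<^sup>2)) powr m = exp (- (m * y)) * (1 - y\<^sup>2) powr m"
    using assms True by (simp add: powr_mult exp_powr_real mult.commute power_le_one)
  finally have "exp (- (m * y)) * (1 - y\<^sup>2) powr m \<le> pos_powr (1 - y) m"
    using True by (simp add: pos_powr_def)
  moreover have "1 - m * y\<^sup>2 \<le> (1 - y\<^sup>2) powr m"
  proof -
    have "1 + m * (- y\<^sup>2) \<le> (1 + (- y\<^sup>2)) powr m"
      using assms True by (intro bernoulli_powr) (auto simp: power_le_one abs_square_less_1)
    then show ?thesis by simp
  qed
  then have "exp (- (m * y)) * (1 - m * y\<^sup>2) \<le> exp (- (m * y)) * (1 - y\<^sup>2) powr m"
    by (intro mult_left_mono) auto
  ultimately show ?thesis
    by (simp add: algebra_simps)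
next
  case False
  \<comment> \<open>For y \<ge> 1 the truncated power is 0, and the factor m y^2 is at least
    1.\<close>
  have "1 \<le> m * y\<^sup>2"
    using mult_mono[OF assms(1), of 1 "y\<^sup>2"] False assms by simp
  then have "1 * exp (- (m * y)) \<le> m * y\<^sup>2 * exp (- (m * y))"
    by (intro mult_right_mono) auto
  then show ?thesis
    using pos_powr_nonneg[of "1 - y" m] by linarith
qed

locale digit_moments =
  fixes b :: nat and A :: "nat set" and s :: complex
  assumes b: "b \<ge> 2" and A: "A \<subseteq> {0..<b}" "A \<noteq> {}" and max_pos: "Max A > 0"
    and s: "Re s > log (real b) (real (card A))"
begin

definition \<kappa> :: real where "\<kappa> = (real b - 1) / real (Max A)"
definition S :: "nat set" where "S = digits_in b ((\<lambda>a. Max A - a) ` A)"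
definition L :: real where "L = ln (real b)"
definition c :: "nat \<Rightarrow> real" where "c n = \<kappa> * real n + 1"
text \<open>The power \<open>c n\<close> to the exponent - s, written with the real logarithm so
  that it merges with the exponentials in the kernel and the modes.\<close>

definition W :: "nat \<Rightarrow> complex" where "W n = exp (- s * of_real (ln (c n)))"
text \<open>The base-b logarithm of \<open>c n\<close>: the translation that rescaling by
  \<open>c n\<close> induces on log_b m.\<close>

definition \<tau> :: "nat \<Rightarrow> real" where "\<tau> n = ln (c n) / L"
definition sk :: "int \<Rightarrow> complex" where "sk k = s - 2 * of_real pi * \<i> * of_int k / of_real L"
definition coef :: "int \<Rightarrow> complex" where "coef k = Gamma (sk k) / of_real L * dirichlet \<kappa> S (sk k)"

lemma L_pos: "L > 0"
  using b by (simp add: L_def)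

lemma finite_A: "finite A"
  by (rule finite_subset[OF A(1)]) simp

text \<open>The largest digit is at most b - 1. Hence \<open>c n\<close> is at least n + 1, which
  makes the terms with n \<ge> b^l vanish.\<close>

lemma kappa_ge_1: "\<kappa> \<ge> 1"
proof -
  have "Max A < b"
    using Max_in[OF finite_A A(2)] A by auto
  then show ?thesis
    using max_pos by (simp add: \<kappa>_def field_simps)
qed

lemma c_ge: "c n \<ge> real n + 1"
  using mult_right_mono[OF kappa_ge_1, of "real n"] by (simp add: c_def)

lemma c_pos: "c n > 0"
  using c_ge[of n] by linarith

lemma Re_s_pos: "Re s > 0"
proof -
  have "log (real b) (real (card A)) \<ge> 0"
    using b finite_A A(2) by (simp add: Suc_le_eq card_gt_0_iff)
  then show ?thesis
    using s by linarith
qed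

lemma norm_W: "norm (W n) = c n powr - Re s"
  using c_pos[of n] by (simp add: W_def powr_def)

lemma W_summable: "(\<lambda>n. norm (W n)) summable_on S"
  unfolding norm_W c_def S_def by (rule digits_in_dirichlet_summable[OF b A refl max_pos s kappa_ge_1])

text \<open>The phase caused by the translation \<open>\<tau> n\<close> moves the exponent from s to
  \<open>sk k\<close>; this is how Dirichlet values on the vertical line become part of the Fourier
  coefficients.\<close>

lemma W_fmode: "W n * fmode k (\<tau> n) = inverse (of_real (c n) powr sk k)"
proof -
  have "of_real (c n) powr sk k = exp (sk k * of_real (ln (c n)))"
    using c_pos[of n] by (simp add: powr_def Ln_of_real)
  moreover have "- (sk k * of_real (ln (c n))) = - s * of_real (ln (c n)) + \<i> * of_real (2 * pi * of_int k * \<tau> n)"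
    using L_pos by (simp add: sk_def \<tau>_def field_simps)
  ultimately show ?thesis
    unfolding W_def fmode_def cis_conv_exp exp_add[symmetric] by (simp add: exp_minus[symmetric])
qed

lemma dirichlet_sk: "dirichlet \<kappa> S (sk k) = (\<Sum>\<^sub>\<infinity>n\<in>S. W n * fmode k (\<tau> n))"
  unfolding dirichlet_def W_fmode c_def ..

lemma norm_dirichlet_le: "norm (dirichlet \<kappa> S (sk k)) \<le> (\<Sum>\<^sub>\<infinity>n\<in>S. norm (W n))"
proof -
  have "norm (\<Sum>\<^sub>\<infinity>n\<in>S. W n * fmode k (\<tau> n)) \<le> (\<Sum>\<^sub>\<infinity>n\<in>S. norm (W n * fmode k (\<tau> n)))"
    by (rule norm_infsum_bound) (simp add: norm_mult W_summable)
  then show ?thesis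
    unfolding dirichlet_sk by (simp add: norm_mult)
qed

text \<open>On the vertical line through s the Dirichlet factor is bounded uniformly in k, so the
  decay of Gamma is inherited.\<close>

lemma coef_rapid_decay: "(\<lambda>k. \<bar>of_int k\<bar> ^ n * norm (coef k)) summable_on UNIV"
proof -
  define Z where "Z = (\<Sum>\<^sub>\<infinity>n\<in>S. norm (W n)) / L"
  have "(\<lambda>k. Z * (\<bar>of_int k\<bar> ^ n * norm (Gamma (sk k)))) summable_on UNIV"
    unfolding sk_def by (intro summable_on_cmult_right Gamma_vertical_summable L_pos Re_s_pos)
  then show ?thesis
  proof (rule summable_on_comparison_test)
    fix k
    have "norm (coef k) = norm (Gamma (sk k)) * (norm (dirichlet \<kappa> S (sk k)) / L)"
      using L_pos by (simp add: coef_def norm_mult norm_divide)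
    also have "\<dots> \<le> norm (Gamma (sk k)) * Z"
      unfolding Z_def using L_pos by (intro mult_left_mono divide_right_mono norm_dirichlet_le) auto
    finally have "\<bar>of_int k\<bar> ^ n * norm (coef k) \<le> \<bar>of_int k\<bar> ^ n * (norm (Gamma (sk k)) * Z)"
      by (rule mult_left_mono) simp
    then show "\<bar>of_int k\<bar> ^ n * norm (coef k) \<le> Z * (\<bar>of_int k\<bar> ^ n * norm (Gamma (sk k)))"
      by (simp add: mult_ac)
  qed simp
qed

lemma coef_summable: "(\<lambda>k. norm (coef k)) summable_on UNIV"
  using coef_rapid_decay[of 0] by simp

section \<open>Two forms of G and their common double sum\<close>

abbreviation G :: "real \<Rightarrow> complex" where "G \<equiv> Gfourier b \<kappa> S s"

lemma G_eq: "G t = (\<Sum>\<^sub>\<infinity>k. coef k * fmode k t)"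
proof -
  have "exp (2 * of_real pi * \<i> * of_int k * of_real t) = fmode k t" for k
    by (simp add: fmode_def cis_conv_exp mult_ac)
  then show ?thesis
    unfolding Gfourier_def L_def[symmetric] sk_def[symmetric] infsum_cmult_right'[symmetric]
    by (simp add: coef_def field_simps)
qed

text \<open>The exponent z is independent of the weights \<open>W n\<close>: z = s gives the main
  term, z = s + 2 the error term.\<close>

lemma theta_family_bound:
  assumes z: "Re z > 0"
  obtains C where "\<And>t. (\<lambda>(n, j). norm (W n * theta_kernel z L (t + \<tau> n + of_int j))) summable_on S \<times> (UNIV :: int set)"
    and "\<And>t. (\<Sum>\<^sub>\<infinity>(n, j)\<in>S \<times> (UNIV :: int set). norm (W n * theta_kernel z L (t + \<tau> n + of_int j))) \<le> C"
    and "\<And>t. (\<lambda>(n, j). W n * theta_kernel z L (t + \<tau> n + of_int j)) summable_on S \<times> (UNIV :: int set)"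
proof -
  obtain C where C: "\<And>t. (\<lambda>j::int. norm (theta_kernel z L (t + of_int j))) summable_on UNIV"
      "\<And>t. (\<Sum>\<^sub>\<infinity>j::int. norm (theta_kernel z L (t + of_int j))) \<le> C"
    using theta_kernel_summable_bound[OF z L_pos] by blast
  have 1: "(\<lambda>j::int. norm (W n * theta_kernel z L (t + \<tau> n + of_int j))) summable_on UNIV" for n t
    unfolding norm_mult by (intro summable_on_cmult_right C)
  have 2: "(\<Sum>\<^sub>\<infinity>j::int. norm (W n * theta_kernel z L (t + \<tau> n + of_int j))) \<le> C * norm (W n)" for n t
    unfolding norm_mult infsum_cmult_right' using mult_left_mono[OF C(2) norm_ge_zero] by (simp add: mult.commute)
  show ?thesis
    by (rule that[of "C * (\<Sum>\<^sub>\<infinity>n\<in>S. norm (W n))"])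
       (rule dominated_double_sum[OF 1 2 W_summable])+
qed

text \<open>Dictionary between logarithmic and multiplicative variables: at this u,
  \<open>exp (L * u)\<close> is m y with y = \<open>c n\<close> b^j, and \<open>W n\<close> cancels
  the power of \<open>c n\<close> contained in exp (s L u).\<close>

lemma exp_L_shift:
  assumes m: "m > 0"
  shows "exp (L * (log b m + \<tau> n + of_int j)) = c n * real b powr of_int j * m"
    and "W n * exp (s * of_real (L * (log b m + \<tau> n + of_int j))) = of_real m powr s * of_nat b powr (of_int j * s)"
proof -
  have Lu: "L * (log b m + \<tau> n + of_int j) = ln m + ln (c n) + of_int j * L"
    using L_pos by (simp add: \<tau>_def log_def L_def[symmetric] field_simps)
  show "exp (L * (log b m + \<tau> n + of_int j)) = c n * real b powr of_int j * m"
    unfolding Lu exp_add using m c_pos[of n] b by (simp add: powr_def L_def mult_ac)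
  have "W n * exp (s * of_real (ln m + ln (c n) + of_int j * L)) = exp (s * of_real (ln m)) * exp (s * (of_int j * of_real L))"
    unfolding W_def exp_add[symmetric] by (simp add: algebra_simps)
  moreover have "of_real m powr s = exp (s * of_real (ln m))"
    using m by (simp add: powr_def Ln_of_real)
  moreover have "of_nat b powr (of_int j * s) = exp (s * (of_int j * of_real L))"
    using b by (simp add: powr_def L_def mult_ac flip: Ln_of_nat)
  ultimately show "W n * exp (s * of_real (L * (log b m + \<tau> n + of_int j))) = of_real m powr s * of_nat b powr (of_int j * s)"
    unfolding Lu by simp
qed

lemma theta_kernel_eq:
  assumes m: "m > 0"
  shows "W n * theta_kernel s L (log b m + \<tau> n + of_int j)
    = of_real m powr s * (of_nat b powr (of_int j * s) * exp (- of_real (c n * real b powr of_int j * m)))"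
proof -
  have "W n * theta_kernel s L (log b m + \<tau> n + of_int j)
      = W n * exp (s * of_real (L * (log b m + \<tau> n + of_int j))) * exp (- of_real (exp (L * (log b m + \<tau> n + of_int j))))"
    by (simp add: theta_kernel_def exp_diff exp_minus divide_inverse)
  then show ?thesis
    unfolding exp_L_shift[OF m] by (simp only: mult.assoc)
qed

lemma Gtheta_eq_double_sum:
  assumes m: "m > 0"
  shows "Gtheta b \<kappa> S s m = (\<Sum>\<^sub>\<infinity>(n, j)\<in>S \<times> (UNIV :: int set). W n * theta_kernel s L (log b m + \<tau> n + of_int j))"
proof -
  let ?T = "\<lambda>n (j::int). W n * theta_kernel s L (log b m + \<tau> n + of_int j)"
  have sum: "(\<lambda>(n, j). ?T n j) summable_on S \<times> (UNIV :: int set)"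
    by (rule theta_family_bound[OF Re_s_pos])
  have "Gtheta b \<kappa> S s m = (\<Sum>\<^sub>\<infinity>j. \<Sum>\<^sub>\<infinity>n\<in>S. ?T n j)"
    unfolding Gtheta_def theta_kernel_eq[OF m] infsum_cmult_right'[symmetric] c_def
    by (simp add: mult_ac)
  also have "\<dots> = (\<Sum>\<^sub>\<infinity>n\<in>S. \<Sum>\<^sub>\<infinity>j. ?T n j)"
    by (rule infsum_swap_banach[OF sum, symmetric])
  also have "\<dots> = (\<Sum>\<^sub>\<infinity>(n, j)\<in>S \<times> UNIV. ?T n j)"
    by (rule infsum_Sigma'_banach[OF sum])
  finally show ?thesis .
qed

text \<open>For fixed n the sum over frequencies k and the sum over translates j agree by Poisson
  summation at t + \<open>\<tau> n\<close>; absolute summability over pairs (n, k) and over pairs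
  (n, j) justifies the rearrangements.\<close>

lemma G_eq_double_sum:
  "G t = (\<Sum>\<^sub>\<infinity>(n, j)\<in>S \<times> (UNIV :: int set). W n * theta_kernel s L (t + \<tau> n + of_int j))"
proof -
  let ?T = "\<lambda>n (j::int). W n * theta_kernel s L (t + \<tau> n + of_int j)"
  let ?g = "\<lambda>k. Gamma (sk k) / of_real L"
  let ?F = "\<lambda>n k. W n * (?g k * fmode k (t + \<tau> n))"
  have sumT: "(\<lambda>(n, j). ?T n j) summable_on S \<times> (UNIV :: int set)"
    by (rule theta_family_bound[OF Re_s_pos])
  have g: "(\<lambda>k. norm (?g k)) summable_on UNIV"
    using summable_on_cmult_right[OF Gamma_vertical_summable[OF L_pos Re_s_pos, of 0], of "1 / L"] L_pos
    by (simp add: norm_divide sk_def)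
  have F1: "(\<lambda>k. norm (?F n k)) summable_on UNIV" for n
    using summable_on_cmult_right[OF g, of "norm (W n)"] by (simp only: norm_mult norm_fmode mult_1_right)
  have F2: "(\<Sum>\<^sub>\<infinity>k. norm (?F n k)) \<le> (\<Sum>\<^sub>\<infinity>k. norm (?g k)) * norm (W n)" for n
    by (simp only: norm_mult norm_fmode mult_1_right infsum_cmult_right' mult.commute order.refl)
  have sumF: "(\<lambda>(n, k). ?F n k) summable_on S \<times> UNIV"
    by (rule dominated_double_sum(3)[OF F1 F2 W_summable])
  have "G t = (\<Sum>\<^sub>\<infinity>k. \<Sum>\<^sub>\<infinity>n\<in>S. ?F n k)"
    unfolding G_eq
  proof (rule infsum_cong)
    fix k
    have "coef k * fmode k t = ?g k * fmode k t * (\<Sum>\<^sub>\<infinity>n\<in>S. W n * fmode k (\<tau> n))"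
      by (simp add: coef_def dirichlet_sk)
    also have "\<dots> = (\<Sum>\<^sub>\<infinity>n\<in>S. ?g k * fmode k t * (W n * fmode k (\<tau> n)))"
      by (rule infsum_cmult_right'[symmetric])
    also have "\<dots> = (\<Sum>\<^sub>\<infinity>n\<in>S. ?F n k)"
      by (intro infsum_cong) (simp add: fmode_add_right mult_ac)
    finally show "coef k * fmode k t = (\<Sum>\<^sub>\<infinity>n\<in>S. ?F n k)" .
  qed
  also have "\<dots> = (\<Sum>\<^sub>\<infinity>n\<in>S. \<Sum>\<^sub>\<infinity>k. ?F n k)"
    by (rule infsum_swap_banach[OF sumF, symmetric])
  also have "\<dots> = (\<Sum>\<^sub>\<infinity>n\<in>S. \<Sum>\<^sub>\<infinity>j. ?T n j)"
  proof (rule infsum_cong)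
    fix n
    have "(\<Sum>\<^sub>\<infinity>k. ?g k * fmode k (t + \<tau> n)) = theta_sum s L (t + \<tau> n)"
      unfolding sk_def by (rule infsumI[OF theta_sum_fourier_series[OF L_pos Re_s_pos]])
    then show "(\<Sum>\<^sub>\<infinity>k. ?F n k) = (\<Sum>\<^sub>\<infinity>j. ?T n j)"
      unfolding infsum_cmult_right' theta_sum_def by (rule arg_cong)
  qed
  also have "\<dots> = (\<Sum>\<^sub>\<infinity>(n, j)\<in>S \<times> UNIV. ?T n j)"
    by (rule infsum_Sigma'_banach[OF sumT])
  finally show ?thesis .
qed

lemma G_eq_Gtheta: "m > 0 \<Longrightarrow> G (log b m) = Gtheta b \<kappa> S s m"
  by (simp only: Gtheta_eq_double_sum G_eq_double_sum)

lemma G_periodic: "G (t + 1) = G t"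
  unfolding G_eq by (simp add: fmode_add_right)


text \<open>The index j is minus the word length. Nonnegative j contribute nothing, which also
  matches the empty word, since 0^m = 0 for m > 0.\<close>

lemma moment_eq_double_sum:
  assumes m: "m > 0"
  defines "Q \<equiv> \<lambda>n (j::int). complex_of_real m powr s * of_nat b powr (of_int j * s) * of_real (pos_powr (1 - c n * real b powr of_int j) m)"
  shows "(\<lambda>(n, j). Q n j) summable_on S \<times> UNIV"
    and "of_real (\<kappa> powr m) * of_real m powr s * moment b A s m = (\<Sum>\<^sub>\<infinity>(n, j)\<in>S \<times> UNIV. Q n j)"
proof -
  let ?T = "\<lambda>n (j::int). W n * theta_kernel s L (log b m + \<tau> n + of_int j)"
  have normT: "(\<lambda>(n, j). norm (?T n j)) summable_on S \<times> (UNIV :: int set)"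
    by (rule theta_family_bound[OF Re_s_pos])
  \<comment> \<open>The inequality 1 - y \<le> e^{-y} dominates the moment terms by the theta
    family, whose summability is already known.\<close>
  have QT: "norm (Q n j) \<le> norm (?T n j)" for n j
    unfolding Q_def theta_kernel_eq[OF m] norm_mult mult.assoc
    using pos_powr_one_minus_le[OF m, of "c n * real b powr of_int j"] pos_powr_nonneg
    by (intro mult_left_mono) (auto simp: norm_exp_eq_Re mult_ac)
  have "(\<lambda>p. norm ((\<lambda>(n, j). Q n j) p)) summable_on S \<times> UNIV"
    by (rule Infinite_Sum.abs_summable_on_comparison_test'[OF normT]) (use QT in auto)
  then show Qsum: "(\<lambda>(n, j). Q n j) summable_on S \<times> UNIV"
    by (rule abs_summable_summable)
  define q where "q = (\<lambda>j. \<Sum>\<^sub>\<infinity>n\<in>S. Q n j)"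
  have Qsum': "(\<lambda>(j, n). Q n j) summable_on UNIV \<times> S"
    using summable_on_swap[of "\<lambda>(n, j). Q n j" S UNIV] Qsum by (simp add: case_prod_unfold)
  have qsum: "q summable_on UNIV"
    unfolding q_def by (rule summable_on_Sigma_banach[OF Qsum'])
  have Qq: "(\<Sum>\<^sub>\<infinity>(n, j)\<in>S \<times> UNIV. Q n j) = infsum q UNIV"
    unfolding q_def infsum_Sigma'_banach[OF Qsum, symmetric] by (rule infsum_swap_banach[OF Qsum])
  have q0: "q j = 0" if "j \<ge> 0" for j
  proof -
    have "Q n j = 0" for n
    proof -
      have "1 * 1 \<le> c n * real b powr of_int j"
        using c_ge[of n] b that by (intro mult_mono) (auto intro: ge_one_powr_ge_zero)
      then show ?thesis
        by (simp add: Q_def pos_powr_def)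
    qed
    then show ?thesis
      by (simp add: q_def)
  qed
  define K where "K = complex_of_real (\<kappa> powr m) * of_real m powr s"
  define M where "M = (\<lambda>l. \<Sum>w\<in>{w. length w = Suc l \<and> set w \<subseteq> A}.
        complex_of_real (rpow0 (wval b w) m) * (of_nat b) powr (- (of_nat (Suc l) * s)))"
  \<comment> \<open>The l-th term of the moment series concerns words of length l + 1, hence j = - l
    - 1. For this j, the terms with n \<ge> b^(l+1) vanish and a finite sum is left.\<close>
  have qM: "q (- int l - 1) = K * M l" for l
  proof -
    have powr_l: "real b powr of_int (- int l - 1) = 1 / real b ^ Suc l"
      using b by (simp add: powr_diff powr_minus powr_realpow field_simps)
    have fin: "finite {n \<in> S. n < b ^ Suc l}"
      by simp
    have "q (- int l - 1) = (\<Sum>\<^sub>\<infinity>n\<in>{n \<in> S. n < b ^ Suc l}. Q n (- int l - 1))"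
      unfolding q_def
    proof (rule infsum_cong_neutral)
      fix n assume "n \<in> S - {n \<in> S. n < b ^ Suc l}"
      then have "real b ^ Suc l \<le> real n"
        by (auto simp del: power_Suc simp flip: of_nat_power)
      then have "real b ^ Suc l \<le> c n"
        using c_ge[of n] by linarith
      then have "1 \<le> c n * real b powr of_int (- int l - 1)"
        unfolding powr_l using b by (simp add: field_simps)
      then show "Q n (- int l - 1) = 0"
        by (simp add: Q_def pos_powr_def)
    qed auto
    also have "\<dots> = (\<Sum>n\<in>{n \<in> S. n < b ^ Suc l}. Q n (- int l - 1))"
      using fin by (rule infsum_finite)
    also have "\<dots> = of_real m powr s * of_nat b powr (- (of_nat (Suc l) * s)) *
        (\<Sum>n\<in>{n \<in> S. n < b ^ Suc l}. complex_of_real (pos_powr (1 - (\<kappa> * real n + 1) / real b ^ Suc l) m))"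
      unfolding sum_distrib_left
    proof (intro sum.cong refl)
      fix n
      have "of_int (- int l - 1) * s = - (of_nat (Suc l) * s)"
        by (simp add: algebra_simps)
      then show "Q n (- int l - 1) = of_real m powr s * of_nat b powr (- (of_nat (Suc l) * s)) *
          complex_of_real (pos_powr (1 - (\<kappa> * real n + 1) / real b ^ Suc l) m)"
        unfolding Q_def powr_l by (simp only: c_def times_divide_eq_right mult_1_right)
    qed
    also have "(\<Sum>n\<in>{n \<in> S. n < b ^ Suc l}. complex_of_real (pos_powr (1 - (\<kappa> * real n + 1) / real b ^ Suc l) m))
        = (\<Sum>w\<in>{w. length w = Suc l \<and> set w \<subseteq> A}. complex_of_real (pos_powr (\<kappa> * wval b w) m))"
      unfolding S_def
      by (rule sum_words_eq_sum_digits[OF A refl max_pos \<kappa>_def, symmetric, of "\<lambda>x. complex_of_real (pos_powr x m)"])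
    also have "\<dots> = (\<Sum>w\<in>{w. length w = Suc l \<and> set w \<subseteq> A}. complex_of_real (\<kappa> powr m) * complex_of_real (rpow0 (wval b w) m))"
    proof (intro sum.cong refl)
      fix w
      show "complex_of_real (pos_powr (\<kappa> * wval b w) m) = complex_of_real (\<kappa> powr m) * complex_of_real (rpow0 (wval b w) m)"
        using wval_nonneg[of b w] kappa_ge_1 m
        by (cases "wval b w = 0") (auto simp: pos_powr_def rpow0_def powr_mult zero_less_mult_iff)
    qed
    finally show ?thesis
      unfolding K_def M_def sum_distrib_left sum_distrib_right by (simp add: mult_ac)
  qed
  have "infsum q UNIV = infsum q (range (\<lambda>l. - int l - 1))"
  proof (rule infsum_cong_neutral)
    fix j :: int assume "j \<in> UNIV - range (\<lambda>l. - int l - 1)"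
    moreover have "j = - int (nat (- j - 1)) - 1" if "j < 0"
      using that by simp
    ultimately have "j \<ge> 0"
      by (metis Diff_iff not_le rangeI)
    then show "q j = 0"
      by (rule q0)
  qed auto
  also have "\<dots> = (\<Sum>\<^sub>\<infinity>l. q (- int l - 1))"
    by (subst infsum_reindex) (auto simp: inj_def o_def)
  also have "\<dots> = (\<Sum>\<^sub>\<infinity>l. K * M l)"
    by (simp only: qM)
  finally have q_inf: "infsum q UNIV = (\<Sum>\<^sub>\<infinity>l. K * M l)" .
  \<comment> \<open>Convergence of the moment series is derived here as well: it is that of q over
    the negative indices, divided by the nonzero constant K.\<close>
  have "q summable_on range (\<lambda>l. - int l - 1)"
    by (rule summable_on_subset_banach[OF qsum]) simp
  then have "(\<lambda>l. K * M l) summable_on UNIV"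
    by (subst (asm) summable_on_reindex) (auto simp: inj_def o_def qM)
  then have "(\<lambda>l. K * M l) sums (\<Sum>\<^sub>\<infinity>l. K * M l)"
    by (intro has_sum_imp_sums has_sum_infsum)
  moreover have "K \<noteq> 0"
    using kappa_ge_1 m by (simp add: K_def)
  ultimately have "M sums ((\<Sum>\<^sub>\<infinity>l. K * M l) / K)"
    by (simp add: sums_mult_D sums_mult_iff)
  then have "suminf M = infsum q UNIV / K"
    unfolding q_inf by (rule sums_unique[symmetric])
  moreover have "moment b A s m = suminf M"
    using m by (simp add: moment_def M_def rpow0_def)
  ultimately show "of_real (\<kappa> powr m) * of_real m powr s * moment b A s m = (\<Sum>\<^sub>\<infinity>(n, j)\<in>S \<times> UNIV. Q n j)"
    unfolding Qq K_def[symmetric] using \<open>K \<noteq> 0\<close> by simp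
qed

lemma scaled_moment_approx:
  obtains C where "\<And>m. m \<ge> 1 \<Longrightarrow>
    norm (of_real (\<kappa> powr m) * of_real m powr s * moment b A s m - G (log b m)) \<le> C / m"
proof -
  have "Re (s + 2) > 0"
    using Re_s_pos by simp
  then obtain C where C:
    "\<And>t. (\<lambda>(n, j). norm (W n * theta_kernel (s + 2) L (t + \<tau> n + of_int j))) summable_on S \<times> (UNIV :: int set)"
    "\<And>t. (\<Sum>\<^sub>\<infinity>(n, j)\<in>S \<times> (UNIV :: int set). norm (W n * theta_kernel (s + 2) L (t + \<tau> n + of_int j))) \<le> C"
    by (rule theta_family_bound) blast
  show ?thesis
  proof (rule that)
    fix m :: real assume m1: "m \<ge> 1"
    then have m: "m > 0" by simp
    let ?Q = "\<lambda>n (j::int). complex_of_real m powr s * of_nat b powr (of_int j * s) * of_real (pos_powr (1 - c n * real b powr of_int j) m)"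
    let ?T = "\<lambda>n (j::int). W n * theta_kernel s L (log b m + \<tau> n + of_int j)"
    let ?E = "\<lambda>n (j::int). norm (W n * theta_kernel (s + 2) L (log b m + \<tau> n + of_int j))"
    have le: "norm (?Q n j - ?T n j) \<le> 1 / m * ?E n j" for n j
    proof -
      define y where "y = c n * real b powr of_int j"
      have y: "y > 0"
        using c_pos[of n] b by (simp add: y_def)
      let ?p = "complex_of_real m powr s * of_nat b powr (of_int j * s)"
      have T: "?T n j = ?p * of_real (exp (- (m * y)))"
        unfolding theta_kernel_eq[OF m] y_def[symmetric] by (simp add: mult_ac flip: exp_of_real)
      have "?Q n j - ?T n j = ?p * of_real (pos_powr (1 - y) m - exp (- (m * y)))"
        unfolding T y_def[symmetric] by (simp add: algebra_simps)
      then have "norm (?Q n j - ?T n j) = norm ?p * \<bar>pos_powr (1 - y) m - exp (- (m * y))\<bar>"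
        by (simp only: norm_mult norm_of_real)
      also have "\<dots> \<le> norm ?p * (m * y\<^sup>2 * exp (- (m * y)))"
        using pos_powr_one_minus_ge[OF m1 y] pos_powr_one_minus_le[OF m, of y]
        by (intro mult_left_mono) auto
      \<comment> \<open>Splitting off 1 / m leaves (m y)^2 e^{-m y}. Since m y = exp (L u), the
        square raises the kernel exponent from s to s + 2, and the resulting double sum is bounded
        uniformly in m.\<close>
      also have "\<dots> = 1 / m * (norm ?p * ((m * y)\<^sup>2 * exp (- (m * y))))"
        using m by (simp add: power2_eq_square)
      also have "norm ?p * ((m * y)\<^sup>2 * exp (- (m * y))) = ?E n j"
      proof -
        let ?u = "log b m + \<tau> n + of_int j"
        have u: "exp (L * ?u) = m * y"
          unfolding exp_L_shift[OF m] y_def by simp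
        have "theta_kernel (s + 2) L ?u = exp (s * of_real (L * ?u)) * of_real ((exp (L * ?u))\<^sup>2 * exp (- exp (L * ?u)))"
          by (simp add: theta_kernel_def exp_of_real[symmetric] exp_add[symmetric] exp_double[symmetric] algebra_simps)
        then have "W n * theta_kernel (s + 2) L ?u = ?p * of_real ((m * y)\<^sup>2 * exp (- (m * y)))"
          unfolding u exp_L_shift(2)[OF m, of n j, symmetric] by (simp only: mult.assoc)
        then show ?thesis
          by (simp only: norm_mult norm_of_real) simp
      qed
      finally show ?thesis .
    qed
    have Q: "((\<lambda>(n, j). ?Q n j) has_sum (of_real (\<kappa> powr m) * of_real m powr s * moment b A s m)) (S \<times> UNIV)"
      unfolding moment_eq_double_sum(2)[OF m] by (rule has_sum_infsum[OF moment_eq_double_sum(1)[OF m]])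
    have "(\<lambda>(n, j). ?T n j) summable_on S \<times> (UNIV :: int set)"
      by (rule theta_family_bound[OF Re_s_pos])
    then have T: "((\<lambda>(n, j). ?T n j) has_sum G (log b m)) (S \<times> UNIV)"
      unfolding G_eq_double_sum by (rule has_sum_infsum)
    have "norm (of_real (\<kappa> powr m) * of_real m powr s * moment b A s m - G (log b m))
        \<le> (\<Sum>\<^sub>\<infinity>p\<in>S \<times> (UNIV :: int set). 1 / m * (\<lambda>(n, j). ?E n j) p)"
    proof (rule norm_infsum_le)
      show "((\<lambda>p. (\<lambda>(n, j). ?Q n j) p - (\<lambda>(n, j). ?T n j) p) has_sum
          (of_real (\<kappa> powr m) * of_real m powr s * moment b A s m - G (log b m))) (S \<times> UNIV)"
        using has_sum_add[OF Q has_sum_uminusI[OF T]] by (simp only: diff_conv_add_uminus)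
      show "((\<lambda>p. 1 / m * (\<lambda>(n, j). ?E n j) p) has_sum (\<Sum>\<^sub>\<infinity>p\<in>S \<times> (UNIV :: int set). 1 / m * (\<lambda>(n, j). ?E n j) p)) (S \<times> UNIV)"
        by (intro has_sum_infsum summable_on_cmult_right C)
      show "norm ((\<lambda>(n, j). ?Q n j) p - (\<lambda>(n, j). ?T n j) p) \<le> 1 / m * (\<lambda>(n, j). ?E n j) p" for p
        using le by (cases p) simp
    qed
    also have "\<dots> = 1 / m * (\<Sum>\<^sub>\<infinity>(n, j)\<in>S \<times> (UNIV :: int set). ?E n j)"
      by (rule infsum_cmult_right')
    also have "\<dots> \<le> 1 / m * C"
      using m by (intro mult_left_mono C) simp
    finally show "norm (of_real (\<kappa> powr m) * of_real m powr s * moment b A s m - G (log b m)) \<le> C / m"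
      by simp
  qed
qed

section \<open>Smoothness and averages\<close>

text \<open>Termwise n-th derivatives; together they form the explicit chain of derivatives that
  witnesses smoothness.\<close>

definition G_deriv :: "nat \<Rightarrow> real \<Rightarrow> complex" where
  "G_deriv n t = (\<Sum>\<^sub>\<infinity>k. (2 * pi * \<i> * of_int k) ^ n * coef k * fmode k t)"

lemma G_deriv_0: "G_deriv 0 = G"
  by (simp add: fun_eq_iff G_deriv_def G_eq)

lemma norm_G_deriv_coef:
  "norm ((2 * pi * \<i> * of_int k) ^ n * coef k) = (2 * pi) ^ n * (\<bar>of_int k\<bar> ^ n * norm (coef k))"
  by (simp add: norm_mult norm_power power_mult_distrib)

lemma G_deriv_coef_summable: "(\<lambda>k. norm ((2 * pi * \<i> * of_int k) ^ n * coef k)) summable_on UNIV"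
  unfolding norm_G_deriv_coef by (intro summable_on_cmult_right coef_rapid_decay)

lemma has_vector_derivative_G_deriv:
  "(G_deriv n has_vector_derivative G_deriv (Suc n) t) (at t)"
proof -
  let ?a = "\<lambda>k. (2 * pi * \<i> * of_int k) ^ n * coef k"
  have "(\<lambda>k. (2 * pi) ^ n * (\<bar>of_int k\<bar> ^ Suc n * norm (coef k))) summable_on UNIV"
    by (intro summable_on_cmult_right coef_rapid_decay)
  then have a': "(\<lambda>k. \<bar>of_int k\<bar> * norm (?a k)) summable_on UNIV"
    unfolding norm_G_deriv_coef by (simp add: mult_ac)
  show ?thesis
    using has_vector_derivative_fmode_series[OF G_deriv_coef_summable a', of t]
    unfolding G_deriv_def[abs_def] by (simp only: power_Suc mult.assoc)
qed

lemma G_lipschitz: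
  obtains M where "M \<ge> 0" "\<And>x y. norm (G x - G y) \<le> M * \<bar>x - y\<bar>"
proof (rule that)
  let ?M = "\<Sum>\<^sub>\<infinity>k. norm ((2 * pi * \<i> * of_int k) ^ 1 * coef k)"
  show "?M \<ge> 0"
    by (rule infsum_nonneg) simp
  show "norm (G x - G y) \<le> ?M * \<bar>x - y\<bar>" for x y
  proof (rule vector_derivative_lipschitz)
    fix u
    show "(G has_vector_derivative G_deriv 1 u) (at u)"
      using has_vector_derivative_G_deriv[of 0 u] by (simp add: G_deriv_0)
    have "norm (G_deriv 1 u) \<le> (\<Sum>\<^sub>\<infinity>k. norm ((2 * pi * \<i> * of_int k) ^ 1 * coef k * fmode k u))"
      unfolding G_deriv_def using G_deriv_coef_summable[of 1]
      by (intro norm_infsum_bound) (simp only: norm_mult norm_fmode mult_1_right)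
    then show "norm (G_deriv 1 u) \<le> ?M"
      by (simp only: norm_mult norm_fmode mult_1_right)
  qed
qed

text \<open>The summand at k = 0 vanishes because of division by zero.\<close>

definition G_primitive :: "real \<Rightarrow> complex" where
  "G_primitive t = (\<Sum>\<^sub>\<infinity>k. coef k / (2 * pi * \<i> * of_int k) * fmode k t)"

text \<open>Removing the mean of G is what allows a periodic primitive; dividing the coefficients by
  2 pi i k only improves their summability.\<close>

lemma has_vector_derivative_G_primitive:
  "(G_primitive has_vector_derivative (G t - coef 0)) (at t)"
proof -
  let ?a = "\<lambda>k. coef k / (2 * pi * \<i> * of_int k)"
  have le: "\<bar>of_int k\<bar> * norm (?a k) \<le> norm (coef k)" "norm (?a k) \<le> norm (coef k)" for k
  proof -
    have shrink: "norm (coef k) / y \<le> norm (coef k)" if "y \<ge> 1" for y :: real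
      using divide_left_mono[OF that norm_ge_zero[of "coef k"]] that by simp
    have "2 * pi \<ge> 1"
      using pi_ge_two by linarith
    moreover have "2 * pi * \<bar>of_int k\<bar> \<ge> 1" if "k \<noteq> 0"
    proof -
      have "\<bar>of_int k\<bar> \<ge> (1 :: real)"
        using that by linarith
      then show ?thesis
        using mult_mono[of 1 "2 * pi" 1 "\<bar>real_of_int k\<bar>"] \<open>2 * pi \<ge> 1\<close> by simp
    qed
    moreover have "norm (?a k) = norm (coef k) / (2 * pi * \<bar>of_int k\<bar>)"
      by (simp add: norm_divide norm_mult)
    moreover have "\<bar>of_int k\<bar> * (norm (coef k) / (2 * pi * \<bar>of_int k\<bar>)) = norm (coef k) / (2 * pi)" if "k \<noteq> 0"
      using that by simp
    ultimately show "\<bar>of_int k\<bar> * norm (?a k) \<le> norm (coef k)" "norm (?a k) \<le> norm (coef k)"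
      using shrink[of "2 * pi"] shrink[of "2 * pi * \<bar>of_int k\<bar>"] by (cases "k = 0"; simp)+
  qed
  have "((\<lambda>t. \<Sum>\<^sub>\<infinity>k. ?a k * fmode k t) has_vector_derivative
      (\<Sum>\<^sub>\<infinity>k. 2 * pi * \<i> * of_int k * ?a k * fmode k t)) (at t)"
    by (rule has_vector_derivative_fmode_series;
        rule summable_on_comparison_test[OF coef_summable]) (use le in auto)
  moreover have "(\<Sum>\<^sub>\<infinity>k. 2 * pi * \<i> * of_int k * ?a k * fmode k t) = G t - coef 0"
  proof (rule infsumI)
    have "((\<lambda>k. coef k * fmode k t) has_sum G t) UNIV"
      unfolding G_eq by (rule has_sum_infsum, rule abs_summable_summable) (simp add: norm_mult coef_summable)
    moreover have "((\<lambda>k. if k = 0 then - coef 0 else 0) has_sum (- coef 0)) UNIV"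
      by (rule has_sum_finite_neutralI[of "{0}"]) auto
    \<comment> \<open>Adding a term supported at k = 0 cancels the mean; on the other side the
      factor k annihilates that index.\<close>
    ultimately have "((\<lambda>k. coef k * fmode k t + (if k = 0 then - coef 0 else 0)) has_sum (G t + - coef 0)) UNIV"
      by (rule has_sum_add)
    also have "(\<lambda>k. coef k * fmode k t + (if k = 0 then - coef 0 else 0))
        = (\<lambda>k. 2 * pi * \<i> * of_int k * ?a k * fmode k t)"
      by (auto simp: fun_eq_iff)
    finally show "((\<lambda>k. 2 * pi * \<i> * of_int k * ?a k * fmode k t) has_sum (G t - coef 0)) UNIV"
      by simp
  qed
  ultimately show ?thesis
    by (simp add: G_primitive_def[abs_def])
qed

lemma G_primitive_of_nat: "G_primitive (of_nat n) = G_primitive 0"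
  unfolding G_primitive_def using fmode_of_int[of _ 0] fmode_of_int[of _ "int n"] by simp

section \<open>The logarithmic average over one period\<close>

lemma coef_0: "coef 0 = Gamma s / of_real (ln (real b)) * dirichlet \<kappa> S s"
  by (simp add: coef_def sk_def L_def)

text \<open>The weights of the average are the cell lengths of the partition of [p, p + 1] by the
  points log_b m; the mesh is controlled by ln (1 + x) \<le> x at x = 1 / (m - 1).\<close>

lemma log_quotient_bounds:
  assumes m: "m > b ^ p"
  shows "0 \<le> log b (real m / (real m - 1))"
    and "log b (real m / (real m - 1)) \<le> 1 / (L * real b ^ p)"
    and "log b (real m / (real m - 1)) = log b (real m) - log b (real (m - 1))"
proof -
  have bp: "real b ^ p \<ge> 1"
    using b by simp
  have m1: "real b ^ p \<le> real (m - 1)"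
    using m unfolding of_nat_power[symmetric] of_nat_le_iff by linarith
  have "m \<ge> 1"
    using m by linarith
  then have m2: "real (m - 1) = real m - 1"
    by (simp add: of_nat_diff)
  have pos: "real m - 1 > 0"
    using bp m1 unfolding m2 by linarith
  show "log b (real m / (real m - 1)) = log b (real m) - log b (real (m - 1))"
    unfolding m2 using pos b by (subst log_divide) auto
  show "0 \<le> log b (real m / (real m - 1))"
    using pos b by simp
  have "ln (real m / (real m - 1)) = ln (1 + 1 / (real m - 1))"
    using pos by (simp add: field_simps)
  also have "\<dots> \<le> 1 / (real m - 1)"
    using pos by (intro ln_add_one_self_le_self) simp
  also have "\<dots> \<le> 1 / real b ^ p"
    using m1 bp pos b unfolding m2 by (intro divide_left_mono mult_pos_pos) auto
  finally have "ln (real m / (real m - 1)) / L \<le> 1 / real b ^ p / L"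
    using L_pos by (intro divide_right_mono) auto
  then show "log b (real m / (real m - 1)) \<le> 1 / (L * real b ^ p)"
    by (simp add: log_def L_def[symmetric] mult.commute)
qed

lemma scaled_moment_average:
  "(\<lambda>p. \<Sum>m\<in>{b ^ p <.. b ^ Suc p}.
      of_real (\<kappa> powr real m) * of_real (real m) powr s * moment b A s (real m)
        * of_real (log b (real m / (real m - 1)))) \<longlonglongrightarrow> coef 0"
proof -
  define H where "H = (\<lambda>m::nat. complex_of_real (\<kappa> powr real m) * of_real (real m) powr s * moment b A s (real m))"
  define h where "h = (\<lambda>m::nat. log b (real m / (real m - 1)))"
  obtain C where C: "\<And>m. m \<ge> 1 \<Longrightarrow>
      norm (of_real (\<kappa> powr m) * of_real m powr s * moment b A s m - G (log b m)) \<le> C / m"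
    using scaled_moment_approx by blast
  obtain M where M: "M \<ge> 0" "\<And>x y. norm (G x - G y) \<le> M * \<bar>x - y\<bar>"
    using G_lipschitz by blast
  have C0: "C \<ge> 0"
    using order_trans[OF norm_ge_zero C[of 1]] by simp
  \<comment> \<open>C accounts for replacing the scaled moment by G, and M / L for the variation of
    G within one cell.\<close>
  define K where "K = C + M / L"
  let ?I = "\<lambda>p. {b ^ p <.. b ^ Suc p}"
  have I: "?I p = {Suc (b ^ p)..b ^ Suc p}" for p
    by auto
  have le: "b ^ p \<le> b ^ Suc p" for p
    using b by (intro power_increasing) auto
  have log_pow: "log b (real (b ^ p)) = real p" for p
    using b by (simp add: log_nat_power)
  have bound: "norm ((\<Sum>m\<in>?I p. H m * of_real (h m)) - coef 0) \<le> K / real b ^ p" for p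
  proof -
    have bp: "real b ^ p \<ge> 1"
      using b by simp
    have sum_h: "(\<Sum>m\<in>?I p. h m) = 1"
    proof -
      have "(\<Sum>m\<in>?I p. h m) = (\<Sum>m\<in>?I p. log b (real m) - log b (real (m - 1)))"
        by (intro sum.cong refl) (simp add: h_def log_quotient_bounds(3)[of p])
      also have "\<dots> = log b (real (b ^ Suc p)) - log b (real (b ^ p))"
        unfolding I by (rule sum_telescope''[OF le])
      also have "\<dots> = 1"
        unfolding log_pow by simp
      finally show ?thesis .
    qed
    have sum_P: "(\<Sum>m\<in>?I p. G_primitive (log b (real m)) - G_primitive (log b (real (m - 1)))) = 0"
      unfolding I sum_telescope''[OF le, of "\<lambda>m. G_primitive (log b (real m))"] log_pow G_primitive_of_nat by simp
    \<comment> \<open>The error on each cell is proportional to its length \<open>h m\<close>. The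
      lengths add up to 1, so the total error over the block is at most K / b^p.\<close>
    have summand_bound: "norm (H m * of_real (h m) - of_real (h m) * coef 0
        - (G_primitive (log b (real m)) - G_primitive (log b (real (m - 1))))) \<le> K / real b ^ p * h m"
      if m: "m \<in> ?I p" for m
    proof -
      have mp: "m > b ^ p"
        using m by simp
      then have bm: "real b ^ p \<le> real m"
        unfolding of_nat_power[symmetric] of_nat_le_iff by linarith
      then have mm: "real m \<ge> 1"
        using bp by linarith
      have Cm: "C / real m \<le> C / real b ^ p"
        by (rule divide_left_mono[OF bm C0]) (intro mult_pos_pos; use bp mm in linarith)
      have hb: "0 \<le> h m" "h m \<le> 1 / (L * real b ^ p)" "h m = log b (real m) - log b (real (m - 1))"
        unfolding h_def by (fact log_quotient_bounds[OF mp])+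
      let ?x = "log b (real m)" and ?y = "log b (real (m - 1))"
      have e1: "norm ((H m - G ?x) * of_real (h m)) \<le> C / real b ^ p * h m"
      proof -
        have "norm (H m - G ?x) \<le> C / real b ^ p"
          using C[OF mm] Cm by (simp add: H_def)
        then show ?thesis
          unfolding norm_mult norm_of_real abs_of_nonneg[OF hb(1)] using hb(1) by (rule mult_right_mono)
      qed
      \<comment> \<open>Over one cell the increment of the primitive is compared with cell length
        times its derivative at the right end; on the cell the derivative varies by at most M times
        the length.\<close>
      have "norm (G_primitive ?x - G_primitive ?y - (?x - ?y) *\<^sub>R (G ?x - coef 0)) \<le> norm (?x - ?y) * (M * h m)"
      proof (rule vector_differentiable_bound_linearization)
        fix u assume "u \<in> closed_segment ?y ?x"
        then have u: "\<bar>u - ?x\<bar> \<le> h m"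
          unfolding hb(3) using hb(1) hb(3) by (auto simp: closed_segment_eq_real_ivl split: if_splits)
        show "(G_primitive has_vector_derivative G u - coef 0) (at u within closed_segment ?y ?x)"
          by (rule has_vector_derivative_at_within[OF has_vector_derivative_G_primitive])
        have "norm (G u - G ?x) \<le> M * \<bar>u - ?x\<bar>"
          by (rule M(2))
        also have "\<dots> \<le> M * h m"
          using u M(1) by (rule mult_left_mono)
        finally show "norm (G u - coef 0 - (G ?x - coef 0)) \<le> M * h m"
          by simp
      qed auto
      also have "norm (?x - ?y) * (M * h m) = M * h m * h m"
        using hb(1) unfolding hb(3)[symmetric] by simp
      also have "\<dots> \<le> M * (1 / (L * real b ^ p)) * h m"
        using M(1) hb(1,2) by (intro mult_right_mono mult_left_mono) auto
      finally have e2: "norm (of_real (h m) * (G ?x - coef 0) - (G_primitive ?x - G_primitive ?y)) \<le> M / L / real b ^ p * h m"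
        unfolding hb(3)[symmetric] by (simp add: norm_minus_commute scaleR_conv_of_real)
      have "H m * of_real (h m) - of_real (h m) * coef 0 - (G_primitive ?x - G_primitive ?y)
          = (H m - G ?x) * of_real (h m) + (of_real (h m) * (G ?x - coef 0) - (G_primitive ?x - G_primitive ?y))"
        by (simp add: algebra_simps)
      also have "norm \<dots> \<le> C / real b ^ p * h m + M / L / real b ^ p * h m"
        by (intro order_trans[OF norm_triangle_ineq] add_mono e1 e2)
      finally show ?thesis
        by (simp add: K_def add_divide_distrib distrib_right)
    qed
    have "(\<Sum>m\<in>?I p. H m * of_real (h m) - of_real (h m) * coef 0
        - (G_primitive (log b (real m)) - G_primitive (log b (real (m - 1)))))
      = (\<Sum>m\<in>?I p. H m * of_real (h m)) - of_real (\<Sum>m\<in>?I p. h m) * coef 0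
        - (\<Sum>m\<in>?I p. G_primitive (log b (real m)) - G_primitive (log b (real (m - 1))))"
      by (simp only: sum_subtractf of_real_sum sum_distrib_right)
    then have "(\<Sum>m\<in>?I p. H m * of_real (h m)) - coef 0 = (\<Sum>m\<in>?I p. H m * of_real (h m) - of_real (h m) * coef 0
        - (G_primitive (log b (real m)) - G_primitive (log b (real (m - 1)))))"
      unfolding sum_h sum_P by simp
    also have "norm \<dots> \<le> (\<Sum>m\<in>?I p. K / real b ^ p * h m)"
      by (rule sum_norm_le) (rule summand_bound)
    also have "\<dots> = K / real b ^ p"
      unfolding sum_distrib_left[symmetric] sum_h by simp
    finally show ?thesis .
  qed
  have "(\<lambda>p. K / real b ^ p) \<longlonglongrightarrow> 0"
    using LIMSEQ_divide_realpow_zero[of "real b" K] b by simp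
  then have "(\<lambda>p. (\<Sum>m\<in>?I p. H m * of_real (h m)) - coef 0) \<longlonglongrightarrow> 0"
    by (rule Lim_null_comparison[rotated]) (use bound in simp)
  then show ?thesis
    unfolding H_def h_def by (simp only: LIM_zero_iff)
qed

end

theorem theorem2:
  fixes b N f :: nat and A :: "nat set" and s :: complex and \<kappa> :: real
  assumes b: "b \<ge> 2"
    and A: "A \<subseteq> {0..<b}" "A \<noteq> {}"
    and N: "N = card A"
    and f: "f = Max A" "f > 0"
    and s: "Re s > log (real b) (real N)"
    and kappa: "\<kappa> = (real b - 1) / real f"
  shows
    "(\<exists>C. \<forall>\<^sub>F m in at_top.
        norm (complex_of_real (\<kappa> powr m) * (complex_of_real m) powr s * moment b A s m
              - Gfourier b \<kappa> (digits_in b ((\<lambda>a. f - a) ` A)) s (log (real b) m)) \<le> C / m)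
     \<and> (\<forall>t. Gfourier b \<kappa> (digits_in b ((\<lambda>a. f - a) ` A)) s (t + 1)
            = Gfourier b \<kappa> (digits_in b ((\<lambda>a. f - a) ` A)) s t)
     \<and> (\<exists>D :: nat \<Rightarrow> real \<Rightarrow> complex.
          D 0 = Gfourier b \<kappa> (digits_in b ((\<lambda>a. f - a) ` A)) s \<and>
          (\<forall>n t. (D n has_vector_derivative D (Suc n) t) (at t)))
     \<and> (\<forall>m::real. m > 0 \<longrightarrow>
          Gfourier b \<kappa> (digits_in b ((\<lambda>a. f - a) ` A)) s (log (real b) m)
          = Gtheta b \<kappa> (digits_in b ((\<lambda>a. f - a) ` A)) s m)
     \<and> ((\<lambda>p::nat. \<Sum>m\<in>{b ^ p <.. b ^ Suc p}.
            complex_of_real (\<kappa> powr real m) * (complex_of_real (real m)) powr s * moment b A s (real m)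
            * complex_of_real (log (real b) (real m / (real m - 1))))
        \<longlonglongrightarrow> Gamma s / complex_of_real (ln (real b)) * dirichlet \<kappa> (digits_in b ((\<lambda>a. f - a) ` A)) s)"
proof -
  interpret d: digit_moments b A s
    by unfold_locales (use b A N f s in auto)
  have \<kappa>: "\<kappa> = d.\<kappa>"
    by (simp add: kappa f d.\<kappa>_def)
  have S: "digits_in b ((\<lambda>a. f - a) ` A) = d.S"
    by (simp add: f d.S_def)
  obtain C where C: "\<And>m. m \<ge> 1 \<Longrightarrow>
      norm (of_real (d.\<kappa> powr m) * of_real m powr s * moment b A s m - d.G (log b m)) \<le> C / m"
    using d.scaled_moment_approx by blast
  have "\<forall>\<^sub>F m in at_top.
      norm (of_real (d.\<kappa> powr m) * of_real m powr s * moment b A s m - d.G (log b m)) \<le> C / m"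
    using eventually_ge_at_top[of 1] by eventually_elim (rule C)
  moreover have "d.G_deriv 0 = d.G \<and> (\<forall>n t. (d.G_deriv n has_vector_derivative d.G_deriv (Suc n) t) (at t))"
    using d.G_deriv_0 d.has_vector_derivative_G_deriv by blast
  ultimately show ?thesis
    unfolding \<kappa> S using d.G_periodic d.G_eq_Gtheta d.scaled_moment_average[unfolded d.coef_0] by blast
qed

end
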